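(* Let $c$ be a positive integer and let $(\mu,\nu),(\mu',\nu')\in \mathbf{T}^2=(\mathbb{R}/\mathbb{Z})^2$. If $(\mu,\nu)$ and $(\mu',\nu')$ belong to the same orbit under the usual action of $GL(2,\mathbb{Z})$ on $\mathbf{T}^2$, then the quantum Heisenberg manifolds $D^c_{\mu\nu}$ and $D^c_{\mu'\nu'}$ are isomorphic $C^*$-algebras.
   Context: A Hilbert $C^*$-bimodule over a $C^*$-algebra $A$ is an $A$-$A$-bimodule $M$ that is both a left and a right Hilbert $C^*$-module over $A$ (with $A$-valued inner products $\langle\cdot,\cdot\rangle_L$, linear in the first variable, and $\langle\cdot,\cdot\rangle_R$, linear in the second variable; neither is assumed full) and satisfies $\langle m,n\rangle_L\,p=m\,\langle n,p\rangle_R$ for all $m,n,p\in M$. Crossed product: a covariant pair for $(A,M)$ in a $C^*$-algebra $B$ is a $*$-homomorphism $i_A:A\to B$ together with a linear map $i_M:M\to B$ such that $i_M(am)=i_A(a)i_M(m)$, $i_M(ma)=i_M(m)i_A(a)$, $i_M(m)i_M(n)^*=i_A(\langle m,n\rangle_L)$ and $i_M(m)^*i_M(n)=i_A(\langle m,n\rangle_R)$. The crossed product $A\rtimes_M\mathbb{Z}$ is the universal $C^*$-algebra for covariant pairs, i.e. it is generated by the images of a covariant pair through which every covariant pair factors by a unique $*$-homomorphism. For a Hilbert $C^*$-bimodule $M$ over a unital $A$ and $\theta\in\mathrm{Aut}(A)$, $M_\theta$ denotes $M$ with the same left action and left inner product, right action $m\cdot a=m\,\theta(a)$ and right inner product $\langle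 x,y\rangle_R^{M_\theta}=\theta^{-1}(\langle x,y\rangle_R^M)$. Write $\mathbf{T}=\mathbb{R}/\mathbb{Z}$ and $e(t)=\exp(2\pi i t)$. For $\nu\in\mathbf{T}$ and a positive integer $c$, $X^c_\nu$ is the vector space of continuous functions $f:\mathbb{R}\times\mathbf{T}\to\mathbb{C}$ with $f(x+1,y)=e(-c(y-\nu))f(x,y)$; it is a Hilbert $C^*$-bimodule over $C(\mathbf{T}^2)$ with left and right actions given by pointwise multiplication and inner products $\langle f,g\rangle_L=f\overline{g}$, $\langle f,g\rangle_R=\overline{f}g$. Let $\alpha_{\mu\nu}\in\mathrm{Aut}(C(\mathbf{T}^2))$ be the automorphism induced by the homeomorphism $(x,y)\mapsto(x+2\mu,y+2\nu)$, i.e. $(\alpha_{\mu\nu}f)(x,y)=f(x-2\mu,y-2\nu)$. The quantum Heisenberg manifold is, up to isomorphism, the crossed product $$D^c_{\mu\nu}= C(\mathbf{T}^2)\rtimes_{(X^c_\nu)_{\alpha_{\mu\nu}}}\mathbb{Z}.$$ The definition depends only on the classes of $\mu,\nu$ modulo $\mathbb{Z}$. *)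

theory Defs
  imports "HOL-Analysis.Analysis"
begin

section \<open>C*-algebras and Hilbert C*-bimodules\<close>

text \<open>Algebras and modules are records with an explicit carrier, so that one can quantify over all
  C*-algebras carried by subsets of a given type. C*-algebras need not be unital.\<close>

record 'v cvec =
  carr :: "'v set"
  vzero :: 'v
  vadd :: "'v \<Rightarrow> 'v \<Rightarrow> 'v"
  vscale :: "complex \<Rightarrow> 'v \<Rightarrow> 'v"

definition vdiff :: "('v, 'x) cvec_scheme \<Rightarrow> 'v \<Rightarrow> 'v \<Rightarrow> 'v"
  where "vdiff V x y = vadd V x (vscale V (-1) y)"

locale complex_vector_space =
  fixes V :: "('v, 'x) cvec_scheme"
  assumes zero_closed: "vzero V \<in> carr V"
    and add_closed: "\<lbrakk>x \<in> carr V; y \<in> carr V\<rbrakk> \<Longrightarrow> vadd V x y \<in> carr V"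
    and scale_closed: "x \<in> carr V \<Longrightarrow> vscale V k x \<in> carr V"
    and add_assoc: "\<lbrakk>x \<in> carr V; y \<in> carr V; z \<in> carr V\<rbrakk> \<Longrightarrow>
      vadd V (vadd V x y) z = vadd V x (vadd V y z)"
    and add_commute: "\<lbrakk>x \<in> carr V; y \<in> carr V\<rbrakk> \<Longrightarrow> vadd V x y = vadd V y x"
    and add_zero: "x \<in> carr V \<Longrightarrow> vadd V x (vzero V) = x"
    and diff_self: "x \<in> carr V \<Longrightarrow> vdiff V x x = vzero V"
    and scale_add_right: "\<lbrakk>x \<in> carr V; y \<in> carr V\<rbrakk> \<Longrightarrow>
      vscale V k (vadd V x y) = vadd V (vscale V k x) (vscale V k y)"
    and scale_add_left: "x \<in> carr V \<Longrightarrow> vscale V (k + l) x = vadd V (vscale V k x) (vscale V l x)"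
    and scale_scale: "x \<in> carr V \<Longrightarrow> vscale V k (vscale V l x) = vscale V (k * l) x"
    and scale_one: "x \<in> carr V \<Longrightarrow> vscale V 1 x = x"

definition linear_on_carr ::
    "('v, 'x) cvec_scheme \<Rightarrow> ('w, 'y) cvec_scheme \<Rightarrow> ('v \<Rightarrow> 'w) \<Rightarrow> bool"
  where "linear_on_carr V W f \<longleftrightarrow>
    f ` carr V \<subseteq> carr W \<and>
    (\<forall>x\<in>carr V. \<forall>y\<in>carr V. f (vadd V x y) = vadd W (f x) (f y)) \<and>
    (\<forall>k. \<forall>x\<in>carr V. f (vscale V k x) = vscale W k (f x))"

definition complete_wrt :: "('v, 'x) cvec_scheme \<Rightarrow> ('v \<Rightarrow> real) \<Rightarrow> bool"
  where "complete_wrt V N \<longleftrightarrow>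
    (\<forall>s. range s \<subseteq> carr V \<and>
        (\<forall>e>0. \<exists>n0::nat. \<forall>m\<ge>n0. \<forall>n\<ge>n0. N (vdiff V (s m) (s n)) < e) \<longrightarrow>
      (\<exists>l\<in>carr V. (\<lambda>n. N (vdiff V (s n) l)) \<longlonglongrightarrow> 0))"

record 'b cstar = "'b cvec" +
  vmult :: "'b \<Rightarrow> 'b \<Rightarrow> 'b"
  vstar :: "'b \<Rightarrow> 'b"
  vnorm :: "'b \<Rightarrow> real"

locale cstar_algebra = complex_vector_space B
  for B :: "('b, 'x) cstar_scheme" +
  assumes mult_closed: "\<lbrakk>x \<in> carr B; y \<in> carr B\<rbrakk> \<Longrightarrow> vmult B x y \<in> carr B"
    and mult_assoc: "\<lbrakk>x \<in> carr B; y \<in> carr B; z \<in> carr B\<rbrakk> \<Longrightarrow>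
      vmult B (vmult B x y) z = vmult B x (vmult B y z)"
    and mult_add_left: "\<lbrakk>x \<in> carr B; y \<in> carr B; z \<in> carr B\<rbrakk> \<Longrightarrow>
      vmult B (vadd B x y) z = vadd B (vmult B x z) (vmult B y z)"
    and mult_add_right: "\<lbrakk>x \<in> carr B; y \<in> carr B; z \<in> carr B\<rbrakk> \<Longrightarrow>
      vmult B x (vadd B y z) = vadd B (vmult B x y) (vmult B x z)"
    and mult_scale_left: "\<lbrakk>x \<in> carr B; y \<in> carr B\<rbrakk> \<Longrightarrow>
      vmult B (vscale B k x) y = vscale B k (vmult B x y)"
    and mult_scale_right: "\<lbrakk>x \<in> carr B; y \<in> carr B\<rbrakk> \<Longrightarrow>
      vmult B x (vscale B k y) = vscale B k (vmult B x y)"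
    and star_closed: "x \<in> carr B \<Longrightarrow> vstar B x \<in> carr B"
    and star_star: "x \<in> carr B \<Longrightarrow> vstar B (vstar B x) = x"
    and star_add: "\<lbrakk>x \<in> carr B; y \<in> carr B\<rbrakk> \<Longrightarrow>
      vstar B (vadd B x y) = vadd B (vstar B x) (vstar B y)"
    and star_scale: "x \<in> carr B \<Longrightarrow> vstar B (vscale B k x) = vscale B (cnj k) (vstar B x)"
    and star_mult: "\<lbrakk>x \<in> carr B; y \<in> carr B\<rbrakk> \<Longrightarrow>
      vstar B (vmult B x y) = vmult B (vstar B y) (vstar B x)"
    and norm_nonneg: "x \<in> carr B \<Longrightarrow> 0 \<le> vnorm B x"
    and norm_eq_zero: "x \<in> carr B \<Longrightarrow> vnorm B x = 0 \<longleftrightarrow> x = vzero B"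
    and norm_triangle: "\<lbrakk>x \<in> carr B; y \<in> carr B\<rbrakk> \<Longrightarrow> vnorm B (vadd B x y) \<le> vnorm B x + vnorm B y"
    and norm_scale: "x \<in> carr B \<Longrightarrow> vnorm B (vscale B k x) = cmod k * vnorm B x"
    and norm_mult: "\<lbrakk>x \<in> carr B; y \<in> carr B\<rbrakk> \<Longrightarrow> vnorm B (vmult B x y) \<le> vnorm B x * vnorm B y"
    and cstar_identity: "x \<in> carr B \<Longrightarrow> vnorm B (vmult B (vstar B x) x) = (vnorm B x)\<^sup>2"
    and complete: "complete_wrt B (vnorm B)"

definition star_hom :: "('a, 'x) cstar_scheme \<Rightarrow> ('b, 'y) cstar_scheme \<Rightarrow> ('a \<Rightarrow> 'b) \<Rightarrow> bool"
  where "star_hom A B f \<longleftrightarrow>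
    linear_on_carr A B f \<and>
    (\<forall>x\<in>carr A. \<forall>y\<in>carr A. f (vmult A x y) = vmult B (f x) (f y)) \<and>
    (\<forall>x\<in>carr A. f (vstar A x) = vstar B (f x))"

definition cstar_isomorphic :: "('a, 'x) cstar_scheme \<Rightarrow> ('b, 'y) cstar_scheme \<Rightarrow> bool"
  where "cstar_isomorphic A B \<longleftrightarrow> (\<exists>f. star_hom A B f \<and> bij_betw f (carr A) (carr B))"

definition generates :: "'b set \<Rightarrow> 'b cstar \<Rightarrow> bool"
  where "generates G B \<longleftrightarrow>
    (\<forall>S. G \<subseteq> S \<and> S \<subseteq> carr B \<and> cstar_algebra (B\<lparr>carr := S\<rparr>) \<longrightarrow> S = carr B)"

definition positive_in :: "('a, 'x) cstar_scheme \<Rightarrow> 'a \<Rightarrow> bool"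
  where "positive_in A x \<longleftrightarrow> (\<exists>b\<in>carr A. x = vmult A (vstar A b) b)"

record ('a, 'm) bimod = "'m cvec" +
  lact :: "'a \<Rightarrow> 'm \<Rightarrow> 'm"
  ract :: "'m \<Rightarrow> 'a \<Rightarrow> 'm"
  lip :: "'m \<Rightarrow> 'm \<Rightarrow> 'a"
  rip :: "'m \<Rightarrow> 'm \<Rightarrow> 'a"

locale left_hilbert_module = A: cstar_algebra A + M: complex_vector_space M
  for A :: "'a cstar" and M :: "('a, 'm) bimod" +
  assumes lact_closed: "\<lbrakk>a \<in> carr A; m \<in> carr M\<rbrakk> \<Longrightarrow> lact M a m \<in> carr M"
    and lact_add_right: "\<lbrakk>a \<in> carr A; m \<in> carr M; n \<in> carr M\<rbrakk> \<Longrightarrow>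
      lact M a (vadd M m n) = vadd M (lact M a m) (lact M a n)"
    and lact_add_left: "\<lbrakk>a \<in> carr A; b \<in> carr A; m \<in> carr M\<rbrakk> \<Longrightarrow>
      lact M (vadd A a b) m = vadd M (lact M a m) (lact M b m)"
    and lact_scale_left: "\<lbrakk>a \<in> carr A; m \<in> carr M\<rbrakk> \<Longrightarrow>
      lact M (vscale A k a) m = vscale M k (lact M a m)"
    and lact_scale_right: "\<lbrakk>a \<in> carr A; m \<in> carr M\<rbrakk> \<Longrightarrow>
      lact M a (vscale M k m) = vscale M k (lact M a m)"
    and lact_mult: "\<lbrakk>a \<in> carr A; b \<in> carr A; m \<in> carr M\<rbrakk> \<Longrightarrow>
      lact M (vmult A a b) m = lact M a (lact M b m)"
    and lip_closed: "\<lbrakk>m \<in> carr M; n \<in> carr M\<rbrakk> \<Longrightarrow> lip M m n \<in> carr A"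
    and lip_add: "\<lbrakk>m \<in> carr M; n \<in> carr M; p \<in> carr M\<rbrakk> \<Longrightarrow>
      lip M (vadd M m n) p = vadd A (lip M m p) (lip M n p)"
    and lip_scale: "\<lbrakk>m \<in> carr M; n \<in> carr M\<rbrakk> \<Longrightarrow> lip M (vscale M k m) n = vscale A k (lip M m n)"
    and lip_lact: "\<lbrakk>a \<in> carr A; m \<in> carr M; n \<in> carr M\<rbrakk> \<Longrightarrow>
      lip M (lact M a m) n = vmult A a (lip M m n)"
    and lip_star: "\<lbrakk>m \<in> carr M; n \<in> carr M\<rbrakk> \<Longrightarrow> vstar A (lip M m n) = lip M n m"
    and lip_positive: "m \<in> carr M \<Longrightarrow> positive_in A (lip M m m)"
    and lip_definite: "m \<in> carr M \<Longrightarrow> lip M m m = vzero A \<Longrightarrow> m = vzero M"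
    and lip_complete: "complete_wrt M (\<lambda>m. sqrt (vnorm A (lip M m m)))"

locale right_hilbert_module = A: cstar_algebra A + M: complex_vector_space M
  for A :: "'a cstar" and M :: "('a, 'm) bimod" +
  assumes ract_closed: "\<lbrakk>a \<in> carr A; m \<in> carr M\<rbrakk> \<Longrightarrow> ract M m a \<in> carr M"
    and ract_add_left: "\<lbrakk>a \<in> carr A; m \<in> carr M; n \<in> carr M\<rbrakk> \<Longrightarrow>
      ract M (vadd M m n) a = vadd M (ract M m a) (ract M n a)"
    and ract_add_right: "\<lbrakk>a \<in> carr A; b \<in> carr A; m \<in> carr M\<rbrakk> \<Longrightarrow>
      ract M m (vadd A a b) = vadd M (ract M m a) (ract M m b)"
    and ract_scale_right: "\<lbrakk>a \<in> carr A; m \<in> carr M\<rbrakk> \<Longrightarrow>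
      ract M m (vscale A k a) = vscale M k (ract M m a)"
    and ract_scale_left: "\<lbrakk>a \<in> carr A; m \<in> carr M\<rbrakk> \<Longrightarrow>
      ract M (vscale M k m) a = vscale M k (ract M m a)"
    and ract_mult: "\<lbrakk>a \<in> carr A; b \<in> carr A; m \<in> carr M\<rbrakk> \<Longrightarrow>
      ract M m (vmult A a b) = ract M (ract M m a) b"
    and rip_closed: "\<lbrakk>m \<in> carr M; n \<in> carr M\<rbrakk> \<Longrightarrow> rip M m n \<in> carr A"
    and rip_add: "\<lbrakk>m \<in> carr M; n \<in> carr M; p \<in> carr M\<rbrakk> \<Longrightarrow>
      rip M m (vadd M n p) = vadd A (rip M m n) (rip M m p)"
    and rip_scale: "\<lbrakk>m \<in> carr M; n \<in> carr M\<rbrakk> \<Longrightarrow> rip M m (vscale M k n) = vscale A k (rip M m n)"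
    and rip_ract: "\<lbrakk>a \<in> carr A; m \<in> carr M; n \<in> carr M\<rbrakk> \<Longrightarrow>
      rip M m (ract M n a) = vmult A (rip M m n) a"
    and rip_star: "\<lbrakk>m \<in> carr M; n \<in> carr M\<rbrakk> \<Longrightarrow> vstar A (rip M m n) = rip M n m"
    and rip_positive: "m \<in> carr M \<Longrightarrow> positive_in A (rip M m m)"
    and rip_definite: "m \<in> carr M \<Longrightarrow> rip M m m = vzero A \<Longrightarrow> m = vzero M"
    and rip_complete: "complete_wrt M (\<lambda>m. sqrt (vnorm A (rip M m m)))"

locale hilbert_bimodule = left_hilbert_module A M + right_hilbert_module A M
  for A :: "'a cstar" and M :: "('a, 'm) bimod" +
  assumes act_assoc: "\<lbrakk>a \<in> carr A; m \<in> carr M; b \<in> carr A\<rbrakk> \<Longrightarrow>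
      ract M (lact M a m) b = lact M a (ract M m b)"
    and ip_compat: "\<lbrakk>m \<in> carr M; n \<in> carr M; p \<in> carr M\<rbrakk> \<Longrightarrow>
      lact M (lip M m n) p = ract M m (rip M n p)"

definition twist :: "'a cstar \<Rightarrow> ('a, 'm) bimod \<Rightarrow> ('a \<Rightarrow> 'a) \<Rightarrow> ('a, 'm) bimod"
  where "twist A M \<theta> = M\<lparr>ract := \<lambda>m a. ract M m (\<theta> a),
    rip := \<lambda>m n. inv_into (carr A) \<theta> (rip M m n)\<rparr>"


section \<open>Crossed products by Hilbert C*-bimodules\<close>

definition covariant_pair ::
    "'a cstar \<Rightarrow> ('a, 'm) bimod \<Rightarrow> 'b cstar \<Rightarrow> ('a \<Rightarrow> 'b) \<Rightarrow> ('m \<Rightarrow> 'b) \<Rightarrow> bool"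
  where "covariant_pair A M B iA iM \<longleftrightarrow>
    star_hom A B iA \<and> linear_on_carr M B iM \<and>
    (\<forall>a\<in>carr A. \<forall>m\<in>carr M. iM (lact M a m) = vmult B (iA a) (iM m)) \<and>
    (\<forall>a\<in>carr A. \<forall>m\<in>carr M. iM (ract M m a) = vmult B (iM m) (iA a)) \<and>
    (\<forall>m\<in>carr M. \<forall>n\<in>carr M. vmult B (iM m) (vstar B (iM n)) = iA (lip M m n)) \<and>
    (\<forall>m\<in>carr M. \<forall>n\<in>carr M. vmult B (vstar B (iM m)) (iM n) = iA (rip M m n))"

text \<open>HOL cannot quantify over types inside a definition, so the universal property has to refer to
  covariant pairs in C*-algebras carried by subsets of one fixed type. It is chosen large enough for
  this to be no restriction: every element of a C*-algebra generated by a covariant pair for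
  \<open>(A, M)\<close> is the limit of a sequence of *-polynomials in generators from \<open>A\<close> and \<open>M\<close>, so every
  such C*-algebra is isomorphic to one carried by sequences of formal *-polynomials
  (lemma \<open>universal_property_any_type\<close> below extends the universal property to all types).\<close>

datatype ('a, 'm) star_poly =
    GenA 'a
  | GenM 'm
  | Plus "('a, 'm) star_poly" "('a, 'm) star_poly"
  | Scale complex "('a, 'm) star_poly"
  | Times "('a, 'm) star_poly" "('a, 'm) star_poly"
  | Adj "('a, 'm) star_poly"

type_synonym ('a, 'm) cp_univ = "nat \<Rightarrow> ('a, 'm) star_poly"

definition factors_via ::
    "'a cstar \<Rightarrow> ('a, 'm) bimod \<Rightarrow> 'd cstar \<Rightarrow> ('a \<Rightarrow> 'd) \<Rightarrow> ('m \<Rightarrow> 'd) \<Rightarrow>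
      'b cstar \<Rightarrow> ('a \<Rightarrow> 'b) \<Rightarrow> ('m \<Rightarrow> 'b) \<Rightarrow> ('d \<Rightarrow> 'b) \<Rightarrow> bool"
  where "factors_via A M D iA iM B jA jM f \<longleftrightarrow>
    star_hom D B f \<and> (\<forall>a\<in>carr A. f (iA a) = jA a) \<and> (\<forall>m\<in>carr M. f (iM m) = jM m)"

definition factors_uniquely ::
    "'a cstar \<Rightarrow> ('a, 'm) bimod \<Rightarrow> 'd cstar \<Rightarrow> ('a \<Rightarrow> 'd) \<Rightarrow> ('m \<Rightarrow> 'd) \<Rightarrow>
      'b cstar \<Rightarrow> ('a \<Rightarrow> 'b) \<Rightarrow> ('m \<Rightarrow> 'b) \<Rightarrow> bool"
  where "factors_uniquely A M D iA iM B jA jM \<longleftrightarrow>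
    (\<exists>f. factors_via A M D iA iM B jA jM f) \<and>
    (\<forall>f g. factors_via A M D iA iM B jA jM f \<and> factors_via A M D iA iM B jA jM g \<longrightarrow>
      (\<forall>x\<in>carr D. f x = g x))"

definition is_crossed_product :: "'a cstar \<Rightarrow> ('a, 'm) bimod \<Rightarrow> 'd cstar \<Rightarrow> bool"
  where "is_crossed_product A M D \<longleftrightarrow>
    hilbert_bimodule A M \<and> cstar_algebra D \<and>
    (\<exists>iA iM. covariant_pair A M D iA iM \<and>
      generates (iA ` carr A \<union> iM ` carr M) D \<and>
      (\<forall>(B :: ('a, 'm) cp_univ cstar) jA jM.
        cstar_algebra B \<and> covariant_pair A M B jA jM \<longrightarrow> factors_uniquely A M D iA iM B jA jM))"


section \<open>The circle group R/Z\<close>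

quotient_type circle = real / "\<lambda>x y. x - y \<in> \<int>"
proof (rule equivpI)
  show "reflp (\<lambda>x y::real. x - y \<in> \<int>)" by (simp add: reflp_def)
  show "symp (\<lambda>x y::real. x - y \<in> \<int>)"
    by (metis (mono_tags, lifting) Ints_minus minus_diff_eq sympI)
  show "transp (\<lambda>x y::real. x - y \<in> \<int>)"
    by (smt (verit) Ints_add transpI)
qed

instantiation circle :: ab_group_add
begin

lift_definition zero_circle :: circle is 0 .

lift_definition plus_circle :: "circle \<Rightarrow> circle \<Rightarrow> circle" is "(+)"
  by (metis (no_types, opaque_lifting) Ints_add add_diff_add)

lift_definition uminus_circle :: "circle \<Rightarrow> circle" is uminus
  by (metis Ints_minus minus_diff_eq minus_diff_minus)

lift_definition minus_circle :: "circle \<Rightarrow> circle \<Rightarrow> circle" is "(-)"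
  by (metis (no_types, opaque_lifting) Ints_diff diff_diff_eq2 add_diff_eq diff_add_eq diff_diff_add
      add.commute)

instance
  by standard (transfer; simp)+

end

instantiation circle :: topological_space
begin

text \<open>the quotient topology\<close>

definition open_circle :: "circle set \<Rightarrow> bool"
  where "open_circle U \<longleftrightarrow> open (abs_circle -` U)"

instance
proof
  show "open (UNIV :: circle set)" by (simp add: open_circle_def)
  show "open (S \<inter> T)" if "open S" "open T" for S T :: "circle set"
    using that by (simp add: open_circle_def open_Int)
  show "open (\<Union>K)" if "\<forall>S\<in>K. open S" for K :: "circle set set"
    using that by (auto simp: open_circle_def vimage_Union)
qed

end

lift_definition zmul :: "int \<Rightarrow> circle \<Rightarrow> circle" is "\<lambda>k x. of_int k * x"
  by (metis Ints_mult Ints_of_int right_diff_distrib)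

lift_definition e_circle :: "circle \<Rightarrow> complex" is "\<lambda>t. exp (2 * of_real pi * \<i> * of_real t)"
proof -
  fix x y :: real assume "x - y \<in> \<int>"
  then obtain n :: int where "x - y = of_int n" by (auto elim: Ints_cases)
  hence "x = y + of_int n" by simp
  thus "exp (2 * of_real pi * \<i> * of_real x) = exp (2 * of_real pi * \<i> * of_real y)"
    by (auto simp: exp_eq algebra_simps intro!: exI[of _ n])
qed

type_synonym torus = "circle \<times> circle"


section \<open>Quantum Heisenberg manifolds\<close>

definition C_torus :: "(torus \<Rightarrow> complex) cstar"
  where "C_torus = \<lparr>carr = {f. continuous_on UNIV f}, vzero = (\<lambda>_. 0),
    vadd = (\<lambda>f g p. f p + g p), vscale = (\<lambda>k f p. k * f p),
    vmult = (\<lambda>f g p. f p * g p), vstar = (\<lambda>f p. cnj (f p)), vnorm = (\<lambda>f. SUP p. cmod (f p))\<rparr>"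

text \<open>A function on \<open>\<real> \<times> \<T>\<close> that is 1-periodic in the first variable, viewed as a function on the
  torus by evaluation at representatives.\<close>

definition descend :: "(real \<times> circle \<Rightarrow> complex) \<Rightarrow> torus \<Rightarrow> complex"
  where "descend h = (\<lambda>(x, y). h (rep_circle x, y))"

definition X_bimod :: "nat \<Rightarrow> circle \<Rightarrow> (torus \<Rightarrow> complex, real \<times> circle \<Rightarrow> complex) bimod"
  where "X_bimod c \<nu> = \<lparr>
    carr = {f. continuous_on UNIV f \<and>
      (\<forall>x y. f (x + 1, y) = e_circle (zmul (- int c) (y - \<nu>)) * f (x, y))},
    vzero = (\<lambda>_. 0), vadd = (\<lambda>f g p. f p + g p), vscale = (\<lambda>k f p. k * f p),
    lact = (\<lambda>a f (x, y). a (abs_circle x, y) * f (x, y)),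
    ract = (\<lambda>f a (x, y). f (x, y) * a (abs_circle x, y)),
    lip = (\<lambda>f g. descend (\<lambda>p. f p * cnj (g p))),
    rip = (\<lambda>f g. descend (\<lambda>p. cnj (f p) * g p))\<rparr>"

definition alpha :: "circle \<Rightarrow> circle \<Rightarrow> (torus \<Rightarrow> complex) \<Rightarrow> torus \<Rightarrow> complex"
  where "alpha \<mu> \<nu> f = (\<lambda>(x, y). f (x - zmul 2 \<mu>, y - zmul 2 \<nu>))"

definition is_quantum_heisenberg_manifold :: "nat \<Rightarrow> circle \<Rightarrow> circle \<Rightarrow> 'd cstar \<Rightarrow> bool"
  where "is_quantum_heisenberg_manifold c \<mu> \<nu> D \<longleftrightarrow>
    is_crossed_product C_torus (twist C_torus (X_bimod c \<nu>) (alpha \<mu> \<nu>)) D"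

definition GL2Z_act :: "int^2^2 \<Rightarrow> torus \<Rightarrow> torus"
  where "GL2Z_act g = (\<lambda>(\<mu>, \<nu>). (zmul (g $ 1 $ 1) \<mu> + zmul (g $ 1 $ 2) \<nu>,
    zmul (g $ 2 $ 1) \<mu> + zmul (g $ 2 $ 2) \<nu>))"

definition same_GL2Z_orbit :: "torus \<Rightarrow> torus \<Rightarrow> bool"
  where "same_GL2Z_orbit p q \<longleftrightarrow> (\<exists>g :: int^2^2. invertible g \<and> GL2Z_act g p = q)"

section \<open>The bimodule of a quantum Heisenberg manifold is a Hilbert C*-bimodule\<close>

lemma abs_circle_eq_iff: "abs_circle x = abs_circle y \<longleftrightarrow> x - y \<in> \<int>"
  using circle.abs_eq_iff by auto

lemma abs_rep_circle [simp]: "abs_circle (rep_circle u) = u"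
  using Quotient_abs_rep[OF Quotient_circle] .

lemma continuous_on_abs_circle: "continuous_on UNIV abs_circle"
  by (simp add: continuous_on_open_vimage open_circle_def)

lemma open_map_abs_circle:
  assumes "open U" shows "open (abs_circle ` U)"
proof -
  have "abs_circle -` (abs_circle ` U) = (\<Union>n::int. (\<lambda>x. x + of_int n) -` U)"
  proof (intro set_eqI iffI)
    fix x assume "x \<in> abs_circle -` (abs_circle ` U)"
    then obtain u where u: "u \<in> U" "u - x \<in> \<int>" by (auto simp: abs_circle_eq_iff) (metis Ints_minus minus_diff_eq)
    then obtain n where "u - x = of_int n" by (auto elim: Ints_cases)
    with u show "x \<in> (\<Union>n::int. (\<lambda>x. x + of_int n) -` U)"
      by (auto intro!: exI[of _ n] simp: algebra_simps)
  next
    fix x assume "x \<in> (\<Union>n::int. (\<lambda>x. x + of_int n) -` U)"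
    then obtain n :: int where "x + of_int n \<in> U" by auto
    moreover have "abs_circle x = abs_circle (x + of_int n)" by (simp add: abs_circle_eq_iff)
    ultimately show "x \<in> abs_circle -` (abs_circle ` U)" by auto
  qed
  moreover have "open ((\<lambda>x. x + real_of_int n) -` U)" for n
    by (intro open_vimage assms continuous_intros)
  ultimately show ?thesis by (simp add: open_circle_def open_UN)
qed

lemma compact_torus: "compact (UNIV :: torus set)"
proof -
  have "abs_circle (frac x) = abs_circle x" for x
    by (simp add: abs_circle_eq_iff frac_def)
  hence "u \<in> abs_circle ` {0..1}" for u
    by (metis abs_rep_circle atLeastAtMost_iff frac_ge_0 frac_lt_1 image_eqI less_eq_real_def)
  hence *: "abs_circle ` {0..1} = UNIV" by blast
  have "compact (abs_circle ` {0..1})"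
    by (intro compact_continuous_image continuous_on_subset[OF continuous_on_abs_circle]) auto
  hence "compact (UNIV :: circle set)" by (simp add: *)
  from compact_Times[OF this this] show ?thesis by simp
qed

lemma continuous_on_torusI:
  assumes "continuous_on UNIV (\<lambda>(x, y). h (abs_circle x, y))"
  shows "continuous_on (UNIV :: torus set) h"
proof (subst continuous_on_open_vimage[OF open_UNIV], intro allI impI)
  fix B :: "'a set" assume "open B"
  let ?q = "\<lambda>(x, y). (abs_circle x, y :: circle)"
  have op: "open ((\<lambda>(x, y). h (abs_circle x, y)) -` B)" (is "open ?W")
    using assms \<open>open B\<close> by (intro open_vimage) auto
  have eq: "h -` B \<inter> UNIV = ?q ` ?W"
  proof (intro set_eqI iffI)
    fix z assume "z \<in> h -` B \<inter> UNIV"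
    thus "z \<in> ?q ` ?W" by (intro image_eqI[where x = "(rep_circle (fst z), snd z)"]) auto
  qed auto
  show "open (h -` B \<inter> UNIV)"
    unfolding eq
  proof (subst open_subopen, intro ballI)
    fix z assume "z \<in> ?q ` ?W"
    then obtain x y where xy: "(x, y) \<in> ?W" "z = (abs_circle x, y)" by auto
    obtain U V where UV: "open U" "open V" "x \<in> U" "y \<in> V" "U \<times> V \<subseteq> ?W"
      using open_prod_elim[OF op xy(1)] by (metis mem_Sigma_iff)
    show "\<exists>T. open T \<and> z \<in> T \<and> T \<subseteq> ?q ` ?W"
    proof (intro exI conjI)
      show "open (abs_circle ` U \<times> V)" by (intro open_Times open_map_abs_circle UV)
      show "z \<in> abs_circle ` U \<times> V" using UV xy by auto
      show "abs_circle ` U \<times> V \<subseteq> ?q ` ?W"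
      proof
        fix w assume "w \<in> abs_circle ` U \<times> V"
        then obtain u v where "u \<in> U" "v \<in> V" "w = ?q (u, v)" by auto
        thus "w \<in> ?q ` ?W" using UV(5) by blast
      qed
    qed
  qed
qed

lemma continuous_on_pullback:
  assumes "continuous_on (UNIV :: torus set) a"
  shows "continuous_on UNIV (\<lambda>(x, y). a (abs_circle x, y))"
proof -
  have "continuous_on UNIV (\<lambda>p :: real \<times> circle. a (abs_circle (fst p), snd p))"
    by (intro continuous_on_compose2[OF assms] continuous_on_Pair
        continuous_on_compose2[OF continuous_on_abs_circle] continuous_intros) auto
  thus ?thesis by (simp add: case_prod_unfold)
qed

lemma periodic_int:
  assumes "\<And>x. h (x + 1) = h (x :: real)" "x - y \<in> \<int>"
  shows "h x = h y"
proof -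
  have nat: "h (z + real n) = h z" for z n
  proof (induction n)
    case (Suc n)
    thus ?case using assms(1)[of "z + real n"] by (simp add: algebra_simps)
  qed simp
  obtain k :: int where k: "x - y = of_int k" using assms(2) by (auto elim: Ints_cases)
  show ?thesis
  proof (cases "k \<ge> 0")
    case True
    then have "x = y + real (nat k)" using k by simp
    thus ?thesis using nat by simp
  next
    case False
    then have "y = x + real (nat (-k))" using k by simp
    thus ?thesis using nat by simp
  qed
qed

lemma descend_abs:
  assumes "\<And>x y. h (x + 1, y) = h (x, y)"
  shows "descend h (abs_circle x, y) = h (x, y)"
proof -
  have "rep_circle (abs_circle x) - x \<in> \<int>" using abs_rep_circle abs_circle_eq_iff by blast
  thus ?thesis using periodic_int[of "\<lambda>x. h (x, y)"] assms by (simp add: descend_def)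
qed

lemma descend_continuous:
  assumes "continuous_on UNIV h" "\<And>x y. h (x + 1, y) = h (x, y)"
  shows "continuous_on UNIV (descend h)"
  using assms by (intro continuous_on_torusI) (simp add: descend_abs case_prod_unfold)

lemma continuous_on_circle_translate: "continuous_on UNIV (\<lambda>u. u - a :: circle)"
proof -
  obtain t where t: "a = abs_circle t" by (metis abs_rep_circle)
  have "abs_circle -` ((\<lambda>u. u - a) -` U) = (\<lambda>x. x - t) -` (abs_circle -` U)" for U
    by (auto simp: t minus_circle.abs_eq)
  moreover have "open ((\<lambda>x. x - t) -` (abs_circle -` U))" if "open U" for U
  proof -
    have "open (abs_circle -` U)" using that by (simp add: open_circle_def)
    thus ?thesis by (rule open_vimage) (intro continuous_intros)
  qed
  ultimately have "open ((\<lambda>u. u - a) -` U)" if "open U" for U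
    using that by (simp add: open_circle_def)
  thus ?thesis by (simp add: continuous_on_open_vimage)
qed

lemma torus_bdd:
  assumes "continuous_on (UNIV :: torus set) (f :: torus \<Rightarrow> complex)"
  shows "bdd_above (range (\<lambda>p. cmod (f p)))"
proof -
  have "compact (range (\<lambda>p. cmod (f p)))"
    by (intro compact_continuous_image compact_torus continuous_intros assms)
  thus ?thesis by (simp add: bounded_imp_bdd_above compact_imp_bounded)
qed

lemma torus_le_norm:
  assumes "f \<in> carr C_torus" shows "cmod (f p) \<le> vnorm C_torus f"
  using assms by (auto simp: C_torus_def intro!: cSUP_upper torus_bdd)

lemma torus_norm_le:
  assumes "\<And>p. cmod (f p) \<le> e" shows "vnorm C_torus f \<le> e"
  using assms by (auto simp: C_torus_def intro!: cSUP_least)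

lemma complete_wrt_pointwise:
  fixes V :: "('p :: topological_space \<Rightarrow> complex, 'x) cvec_scheme"
  assumes cont: "\<And>f. f \<in> carr V \<Longrightarrow> continuous_on UNIV f"
    and diff: "\<And>f g. f \<in> carr V \<Longrightarrow> g \<in> carr V \<Longrightarrow> vdiff V f g = (\<lambda>p. f p - g p)"
    and diff_closed: "\<And>f g. f \<in> carr V \<Longrightarrow> g \<in> carr V \<Longrightarrow> vdiff V f g \<in> carr V"
    and ge: "\<And>f p. f \<in> carr V \<Longrightarrow> cmod (f p) \<le> N f"
    and le: "\<And>f e. f \<in> carr V \<Longrightarrow> (\<And>p. cmod (f p) \<le> e) \<Longrightarrow> N f \<le> e"
    and closed: "\<And>s l. range s \<subseteq> carr V \<Longrightarrow> (\<And>p. (\<lambda>n::nat. s n p) \<longlonglongrightarrow> l p) \<Longrightarrow>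
      continuous_on UNIV l \<Longrightarrow> l \<in> carr V"
  shows "complete_wrt V N"
  unfolding complete_wrt_def
proof (intro allI impI, elim conjE)
  fix s :: "nat \<Rightarrow> 'p \<Rightarrow> complex"
  assume s: "range s \<subseteq> carr V"
    and cauchy: "\<forall>e>0. \<exists>n0. \<forall>m\<ge>n0. \<forall>n\<ge>n0. N (vdiff V (s m) (s n)) < e"
  have sV: "s n \<in> carr V" for n using s by auto
  have pt: "cmod (s m p - s n p) \<le> N (vdiff V (s m) (s n))" for m n p
    using ge[OF diff_closed[OF sV sV], of m n p] by (simp add: diff[OF sV sV])
  have "uniformly_Cauchy_on UNIV s"
    unfolding uniformly_Cauchy_on_def dist_norm using cauchy pt by (meson le_less_trans)
  then obtain l where l: "uniform_limit UNIV s l sequentially"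
    using Cauchy_uniformly_convergent uniformly_convergent_on_def by blast
  have "continuous_on UNIV l"
    by (rule uniform_limit_theorem[OF _ l]) (auto simp: cont sV)
  hence lV: "l \<in> carr V" using closed[OF s] tendsto_uniform_limitI[OF l] by simp
  have "(\<lambda>n. N (vdiff V (s n) l)) \<longlonglongrightarrow> 0"
  proof (rule LIMSEQ_I)
    fix r :: real assume "r > 0"
    then obtain n0 where n0: "\<And>n p. n \<ge> n0 \<Longrightarrow> dist (s n p) (l p) < r / 2"
      using uniform_limitD[OF l, of "r / 2"] by (auto simp: eventually_sequentially)
    show "\<exists>n0. \<forall>n\<ge>n0. norm (N (vdiff V (s n) l) - 0) < r"
    proof (intro exI allI impI)
      fix n assume "n \<ge> n0"
      hence "N (vdiff V (s n) l) \<le> r / 2"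
        using n0 by (intro le diff_closed sV lV) (auto simp: diff[OF sV lV] dist_norm less_imp_le)
      moreover have "0 \<le> N (vdiff V (s n) l)"
        using ge[OF diff_closed[OF sV lV]] norm_ge_zero order_trans by blast
      ultimately show "norm (N (vdiff V (s n) l) - 0) < r" using \<open>r > 0\<close> by simp
    qed
  qed
  thus "\<exists>l\<in>carr V. (\<lambda>n. N (vdiff V (s n) l)) \<longlonglongrightarrow> 0" using lV by blast
qed

lemma cstar_algebra_C_torus: "cstar_algebra C_torus"
proof -
  let ?A = "C_torus"
  have sel: "carr ?A = {f. continuous_on UNIV f}" "vzero ?A = (\<lambda>_. 0)"
    "\<And>f g. vadd ?A f g = (\<lambda>p. f p + g p)" "\<And>k f. vscale ?A k f = (\<lambda>p. k * f p)"
    "\<And>f g. vmult ?A f g = (\<lambda>p. f p * g p)" "\<And>f. vstar ?A f = (\<lambda>p. cnj (f p))"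
    by (simp_all add: C_torus_def)
  have nonneg: "0 \<le> vnorm ?A f" if "f \<in> carr ?A" for f
    using torus_le_norm[OF that] norm_ge_zero order_trans by blast
  show ?thesis
  proof
    show "complete_wrt C_torus (vnorm C_torus)"
      by (rule complete_wrt_pointwise)
        (auto simp: sel vdiff_def torus_le_norm torus_norm_le intro: continuous_intros)
    fix f assume f: "f \<in> carr ?A"
    show "vnorm ?A f = 0 \<longleftrightarrow> f = vzero ?A"
    proof
      assume "vnorm ?A f = 0"
      thus "f = vzero ?A" using torus_le_norm[OF f] by (auto simp: sel)
    next
      assume "f = vzero ?A"
      thus "vnorm ?A f = 0" by (simp add: C_torus_def)
    qed
    show "0 \<le> vnorm ?A f" using nonneg f .
    have scale_le: "vnorm ?A (vscale ?A k g) \<le> cmod k * vnorm ?A g" if "g \<in> carr ?A" for k g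
      using torus_le_norm[OF that] by (intro torus_norm_le) (simp add: sel norm_mult mult_left_mono)
    show "vnorm ?A (vscale ?A k f) = cmod k * vnorm ?A f" for k
    proof (rule antisym)
      show "vnorm ?A (vscale ?A k f) \<le> cmod k * vnorm ?A f" using scale_le f .
      show "cmod k * vnorm ?A f \<le> vnorm ?A (vscale ?A k f)"
      proof (cases "k = 0")
        case True
        have "vscale ?A 0 f \<in> carr ?A" by (simp add: sel)
        thus ?thesis using True nonneg by simp
      next
        case False
        have kf: "vscale ?A k f \<in> carr ?A" using f by (auto simp: sel intro: continuous_intros)
        have "vscale ?A (1 / k) (vscale ?A k f) = f" using False by (simp add: sel)
        with scale_le[OF kf, of "1 / k"] False show ?thesis by (simp add: norm_divide field_simps)
      qed
    qed
    show "vnorm ?A (vmult ?A (vstar ?A f) f) = (vnorm ?A f)\<^sup>2"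
    proof (rule antisym)
      show "vnorm ?A (vmult ?A (vstar ?A f) f) \<le> (vnorm ?A f)\<^sup>2"
        using torus_le_norm[OF f] nonneg[OF f]
        by (intro torus_norm_le) (simp add: sel norm_mult power2_eq_square mult_mono)
      have ff: "vmult ?A (vstar ?A f) f \<in> carr ?A"
        using f by (auto simp: sel intro: continuous_intros)
      have "cmod (f p) \<le> sqrt (vnorm ?A (vmult ?A (vstar ?A f) f))" for p
        using torus_le_norm[OF ff, of p]
        by (intro real_le_rsqrt) (simp add: sel norm_mult power2_eq_square)
      hence "vnorm ?A f \<le> sqrt (vnorm ?A (vmult ?A (vstar ?A f) f))" by (rule torus_norm_le)
      thus "(vnorm ?A f)\<^sup>2 \<le> vnorm ?A (vmult ?A (vstar ?A f) f)"
        using nonneg[OF f] nonneg[OF ff] by (metis power_mono real_sqrt_pow2)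
    qed
    fix g assume g: "g \<in> carr ?A"
    show "vnorm ?A (vadd ?A f g) \<le> vnorm ?A f + vnorm ?A g"
      using torus_le_norm[OF f] torus_le_norm[OF g]
      by (intro torus_norm_le) (simp add: sel norm_triangle_le add_mono)
    show "vnorm ?A (vmult ?A f g) \<le> vnorm ?A f * vnorm ?A g"
      using torus_le_norm[OF f] torus_le_norm[OF g] nonneg[OF f]
      by (intro torus_norm_le) (simp add: sel norm_mult mult_mono)
  qed (auto simp: sel vdiff_def algebra_simps intro: continuous_intros)
qed


lemma alpha_closed:
  assumes "f \<in> carr C_torus" shows "alpha \<mu> \<nu> f \<in> carr C_torus"
proof -
  have "continuous_on UNIV (\<lambda>p :: torus. fst p - a)" for a
    by (rule continuous_on_compose2[OF continuous_on_circle_translate])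
      (auto intro: continuous_intros)
  moreover have "continuous_on UNIV (\<lambda>p :: torus. snd p - a)" for a
    by (rule continuous_on_compose2[OF continuous_on_circle_translate])
      (auto intro: continuous_intros)
  ultimately have "continuous_on UNIV (\<lambda>p :: torus. (fst p - zmul 2 \<mu>, snd p - zmul 2 \<nu>))"
    by (rule continuous_on_Pair)
  moreover have "continuous_on UNIV f" using assms by (simp add: C_torus_def)
  ultimately have "continuous_on UNIV (\<lambda>p. f (fst p - zmul 2 \<mu>, snd p - zmul 2 \<nu>))"
    using continuous_on_compose2 by blast
  thus ?thesis by (simp add: alpha_def case_prod_unfold C_torus_def)
qed

lemma zmul_minus: "zmul k (- u) = - zmul k u"
  by transfer simp

lemma alpha_alpha_minus: "alpha \<mu> \<nu> (alpha (- \<mu>) (- \<nu>) f) = f"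
  by (auto simp: alpha_def zmul_minus)

lemma bij_betw_alpha: "bij_betw (alpha \<mu> \<nu>) (carr C_torus) (carr C_torus)"
proof (rule bij_betwI[where g = "alpha (- \<mu>) (- \<nu>)"])
  show "alpha (- \<mu>) (- \<nu>) (alpha \<mu> \<nu> f) = f" for f
    using alpha_alpha_minus[of "- \<mu>" "- \<nu>" f] by simp
qed (simp_all add: alpha_closed alpha_alpha_minus)

lemma inv_into_alpha:
  assumes "f \<in> carr C_torus"
  shows "inv_into (carr C_torus) (alpha \<mu> \<nu>) f = alpha (- \<mu>) (- \<nu>) f"
  by (rule inv_into_f_eq)
    (simp_all add: bij_betw_imp_inj_on[OF bij_betw_alpha] alpha_closed[OF assms] alpha_alpha_minus)

lemma star_hom_alpha: "star_hom C_torus C_torus (alpha \<mu> \<nu>)"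
  unfolding star_hom_def linear_on_carr_def
  by (intro conjI image_subsetI alpha_closed) (auto simp: C_torus_def alpha_def)

lemma e_circle_norm: "cmod (e_circle u) = 1"
  by transfer simp

lemma hilbert_bimodule_QHM:
  "hilbert_bimodule C_torus (twist C_torus (X_bimod c \<nu>) (alpha \<mu> \<nu>))" (is "hilbert_bimodule ?A ?M")
proof -
  interpret A: cstar_algebra C_torus by (rule cstar_algebra_C_torus)
  let ?X = "X_bimod c \<nu>"
  let ?\<alpha> = "alpha \<mu> \<nu>" and ?\<beta> = "alpha (- \<mu>) (- \<nu>)"
  have sel: "carr ?A = {f. continuous_on UNIV f}" "vzero ?A = (\<lambda>_. 0)"
    "\<And>f g. vadd ?A f g = (\<lambda>p. f p + g p)" "\<And>k f. vscale ?A k f = (\<lambda>p. k * f p)"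
    "\<And>f g. vmult ?A f g = (\<lambda>p. f p * g p)" "\<And>f. vstar ?A f = (\<lambda>p. cnj (f p))"
    by (simp_all add: C_torus_def)
  have carrM: "carr ?M = carr ?X" by (simp add: twist_def)
  have selM: "vzero ?M = (\<lambda>_. 0)" "\<And>f g. vadd ?M f g = (\<lambda>p. f p + g p)"
    "\<And>k f. vscale ?M k f = (\<lambda>p. k * f p)"
    "\<And>a f. lact ?M a f = (\<lambda>(x, y). a (abs_circle x, y) * f (x, y))"
    "\<And>a f. ract ?M f a = (\<lambda>(x, y). f (x, y) * ?\<alpha> a (abs_circle x, y))"
    "\<And>f g. lip ?M f g = lip ?X f g"
    by (simp_all add: twist_def X_bimod_def)
  have selX: "carr ?X = {f. continuous_on UNIV f \<and>
      (\<forall>x y. f (x + 1, y) = e_circle (zmul (- int c) (y - \<nu>)) * f (x, y))}"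
    "\<And>f g. lip ?X f g = descend (\<lambda>p. f p * cnj (g p))"
    "\<And>f g. rip ?X f g = descend (\<lambda>p. cnj (f p) * g p)"
    by (simp_all add: X_bimod_def)
  have Mcont: "continuous_on UNIV f" if "f \<in> carr ?X" for f using that by (simp add: selX)
  have per: "f (x + 1, y) * cnj (g (x + 1, y)) = f (x, y) * cnj (g (x, y))"
    if "f \<in> carr ?X" "g \<in> carr ?X" for f g x y
  proof -
    have "e_circle w * cnj (e_circle w) = 1" for w
      using e_circle_norm[of w] by (simp add: complex_norm_square[symmetric])
    thus ?thesis using that by (simp add: selX mult.assoc mult.left_commute)
  qed
  have lip: "lip ?X f g (abs_circle x, y) = f (x, y) * cnj (g (x, y))"
    and rip: "rip ?X f g (abs_circle x, y) = cnj (f (x, y)) * g (x, y)"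
    if "f \<in> carr ?X" "g \<in> carr ?X" for f g x y
    using per[OF that] per[OF that(2,1)]
    by (simp_all add: selX descend_abs mult.commute)
  have lip_A: "lip ?X f g \<in> carr ?A" and rip_A: "rip ?X f g \<in> carr ?A"
    if "f \<in> carr ?X" "g \<in> carr ?X" for f g
    using per[OF that] per[OF that(2,1)] Mcont[OF that(1)] Mcont[OF that(2)]
    by (auto simp: selX sel mult.commute intro!: descend_continuous continuous_intros)
  have ripM: "rip ?M f g = ?\<beta> (rip ?X f g)" if "f \<in> carr ?X" "g \<in> carr ?X" for f g
    using inv_into_alpha[OF rip_A[OF that]] by (simp add: twist_def)
  have torus_ext: "F = G" if "\<And>x y. F (abs_circle x, y) = G (abs_circle x, y)" for F G :: "torus \<Rightarrow> complex"
    using that by (metis abs_rep_circle ext surj_pair)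
  note A_eqI = torus_ext
  have vs: "complex_vector_space ?M"
    by standard (auto simp: carrM selM selX vdiff_def algebra_simps intro!: continuous_intros)
  interpret M: complex_vector_space ?M by (rule vs)
  have lact: "lact ?M a f \<in> carr ?X" and ract: "ract ?M f a \<in> carr ?X"
    if "a \<in> carr ?A" "f \<in> carr ?X" for a f
  proof -
    have *: "(\<lambda>p. b (abs_circle (fst p), snd p) * f p) \<in> carr ?X" if "b \<in> carr ?A" for b
    proof -
      have "continuous_on UNIV (\<lambda>p :: real \<times> circle. b (abs_circle (fst p), snd p))"
        using continuous_on_pullback[of b] that by (simp add: sel case_prod_unfold)
      moreover have "abs_circle (x + 1) = abs_circle x" for x by (simp add: abs_circle_eq_iff)
      ultimately show ?thesis using \<open>f \<in> carr ?X\<close> by (auto simp: selX intro: continuous_intros)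
    qed
    show "lact ?M a f \<in> carr ?X" using *[OF that(1)] by (simp add: selM case_prod_unfold)
    show "ract ?M f a \<in> carr ?X"
      using *[OF alpha_closed[OF that(1)]] by (simp add: selM case_prod_unfold mult.commute)
  qed
  have ip_sq: "lip ?X f f (abs_circle x, y) = of_real ((cmod (f (x, y)))\<^sup>2)"
    "rip ?X f f (abs_circle x, y) = of_real ((cmod (f (x, y)))\<^sup>2)" if "f \<in> carr ?X" for f x y
    using lip[OF that that] rip[OF that that] by (simp_all add: complex_norm_square mult.commute flip: of_real_power)
  have pos: "positive_in ?A F" if F: "F \<in> carr ?A" "\<And>p. \<exists>r\<ge>0. F p = of_real r" for F
    unfolding positive_in_def
  proof
    let ?b = "\<lambda>p. of_real (sqrt (cmod (F p))) :: complex"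
    show "?b \<in> carr ?A" using F(1) by (auto simp: sel intro: continuous_intros)
    have "F p = cnj (?b p) * ?b p" for p
    proof -
      obtain r where "r \<ge> 0" "F p = of_real r" using F(2) by blast
      thus ?thesis by (simp flip: of_real_mult)
    qed
    thus "F = vmult ?A (vstar ?A ?b) ?b" by (auto simp: sel)
  qed
  have compl: "complete_wrt ?M N"
    if N: "\<And>f. f \<in> carr ?X \<Longrightarrow> N f = sqrt (vnorm ?A (ip f))"
      "\<And>f. f \<in> carr ?X \<Longrightarrow> ip f \<in> carr ?A"
      "\<And>f p. f \<in> carr ?X \<Longrightarrow> \<exists>q. cmod (ip f q) = (cmod (f p))\<^sup>2"
      "\<And>f q. f \<in> carr ?X \<Longrightarrow> \<exists>p. cmod (ip f q) = (cmod (f p))\<^sup>2" for N ip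
  proof (rule complete_wrt_pointwise)
    fix f assume f: "f \<in> carr ?M"
    show "continuous_on UNIV f" using f Mcont by (simp add: carrM)
    show "cmod (f p) \<le> N f" for p
    proof -
      obtain q where "cmod (ip f q) = (cmod (f p))\<^sup>2" using N(3) f carrM by blast
      moreover have "cmod (ip f q) \<le> vnorm ?A (ip f)" using N(2) f carrM torus_le_norm by blast
      ultimately show ?thesis using f N(1) carrM by (simp add: real_le_rsqrt)
    qed
    show "N f \<le> e" if le: "\<And>p. cmod (f p) \<le> e" for e
    proof -
      have "0 \<le> e" using le norm_ge_zero order_trans by blast
      have "vnorm ?A (ip f) \<le> e\<^sup>2"
      proof (rule torus_norm_le)
        fix q
        obtain p where "cmod (ip f q) = (cmod (f p))\<^sup>2" using N(4) f carrM by blast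
        thus "cmod (ip f q) \<le> e\<^sup>2" using le[of p] by (simp add: power_mono)
      qed
      thus ?thesis using f N(1) carrM \<open>0 \<le> e\<close> by (simp add: real_le_lsqrt)
    qed
    fix g assume g: "g \<in> carr ?M"
    show "vdiff ?M f g = (\<lambda>p. f p - g p)" by (simp add: vdiff_def selM)
    show "vdiff ?M f g \<in> carr ?M" using f g by (simp add: vdiff_def M.add_closed M.scale_closed)
  next
    fix s l
    assume s: "range s \<subseteq> carr ?M" and l: "\<And>p. (\<lambda>n::nat. s n p) \<longlonglongrightarrow> l p"
      and cont: "continuous_on UNIV l"
    have "l (x + 1, y) = e_circle (zmul (- int c) (y - \<nu>)) * l (x, y)" (is "_ = ?k * _") for x y
    proof -
      have "s n (x + 1, y) = ?k * s n (x, y)" for n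
        using s by (auto simp: carrM selX)
      hence "(\<lambda>n. s n (x + 1, y)) \<longlonglongrightarrow> ?k * l (x, y)" using tendsto_mult_left[OF l] by simp
      thus ?thesis using l LIMSEQ_unique by blast
    qed
    thus "l \<in> carr ?M" using cont by (simp add: carrM selX)
  qed
  have circ: "\<exists>x. u = abs_circle x" for u by (metis abs_rep_circle)
  have beta: "?\<beta> F (u - zmul 2 \<mu>, v - zmul 2 \<nu>) = F (u, v)" for F u v
    by (simp add: alpha_def zmul_minus)
  have beta_hom: "\<And>F. ?\<beta> (vstar ?A F) = vstar ?A (?\<beta> F)"
    "\<And>F G. ?\<beta> (vadd ?A F G) = vadd ?A (?\<beta> F) (?\<beta> G)"
    "\<And>F k. ?\<beta> (vscale ?A k F) = vscale ?A k (?\<beta> F)"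
    "\<And>F G. ?\<beta> (vmult ?A F G) = vmult ?A (?\<beta> F) (?\<beta> G)"
    by (auto simp: sel alpha_def)
  have beta_alpha: "?\<beta> (?\<alpha> F) = F" for F
    using alpha_alpha_minus[of "- \<mu>" "- \<nu>" F] by simp
  show ?thesis
  proof
    fix m assume m: "m \<in> carr ?M"
    note m' = m[unfolded carrM]
    show "positive_in ?A (lip ?M m m)"
      unfolding selM
    proof (rule pos[OF lip_A[OF m' m']])
      fix p :: torus
      obtain x y where "p = (abs_circle x, y)" using circ by (metis surj_pair)
      thus "\<exists>r\<ge>0. lip ?X m m p = of_real r" using ip_sq[OF m'] by (metis zero_le_power2)
    qed
    show "positive_in ?A (rip ?M m m)"
      unfolding ripM[OF m' m']
    proof (rule pos[OF alpha_closed[OF rip_A[OF m' m']]])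
      fix p :: torus
      obtain x y where "fst p + zmul 2 \<mu> = abs_circle x" "snd p + zmul 2 \<nu> = y"
        using circ by (metis surj_pair)
      hence "?\<beta> (rip ?X m m) p = rip ?X m m (abs_circle x, y)"
        by (auto simp: alpha_def zmul_minus split: prod.splits)
      thus "\<exists>r\<ge>0. ?\<beta> (rip ?X m m) p = of_real r" using ip_sq[OF m'] by (metis zero_le_power2)
    qed
    show "m = vzero ?M" if "lip ?M m m = vzero ?A"
    proof -
      have "cmod (m (x, y)) = 0" for x y
        using ip_sq(1)[OF m', of x y] that by (simp add: selM sel)
      thus ?thesis by (auto simp: selM)
    qed
    show "m = vzero ?M" if "rip ?M m m = vzero ?A"
    proof -
      have "rip ?X m m (u, v) = 0" for u v
        using beta[of "rip ?X m m" u v] that by (simp add: ripM[OF m' m'] sel)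
      hence "cmod (m (x, y)) = 0" for x y
        using ip_sq(2)[OF m', of x y] by simp
      thus ?thesis by (auto simp: selM)
    qed
    fix a assume a: "a \<in> carr ?A"
    show "lact ?M a m \<in> carr ?M" "ract ?M m a \<in> carr ?M" using lact ract a m by (simp_all add: carrM)
    fix b assume b: "b \<in> carr ?A"
    show "ract ?M (lact ?M a m) b = lact ?M a (ract ?M m b)"
      by (auto simp: selM)
  next
    fix m n assume mn: "m \<in> carr ?M" "n \<in> carr ?M"
    note mn' = mn[unfolded carrM]
    show "lip ?M m n \<in> carr ?A" using lip_A mn' by (simp add: selM)
    show "rip ?M m n \<in> carr ?A" using rip_A mn' alpha_closed by (simp add: ripM)
    show "vstar ?A (lip ?M m n) = lip ?M n m"
      by (rule A_eqI) (simp add: sel selM lip mn')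
    show "vstar ?A (rip ?M m n) = rip ?M n m"
    proof -
      have "vstar ?A (rip ?X m n) = rip ?X n m"
        by (rule A_eqI) (simp add: sel rip mn')
      thus ?thesis by (simp add: ripM mn' flip: beta_hom)
    qed
    show "lip ?M (vscale ?M k m) n = vscale ?A k (lip ?M m n)" for k
      using M.scale_closed[OF mn(1), of k]
      by (intro A_eqI) (simp add: sel carrM selM lip mn')
    show "rip ?M m (vscale ?M k n) = vscale ?A k (rip ?M m n)" for k
    proof -
      have kn: "vscale ?M k n \<in> carr ?X" using M.scale_closed[OF mn(2), of k] by (simp add: carrM)
      have "rip ?X m (vscale ?M k n) = vscale ?A k (rip ?X m n)"
        by (rule A_eqI) (use kn in \<open>simp add: sel selM rip mn'\<close>)
      thus ?thesis by (simp add: ripM mn' kn beta_hom)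
    qed
    fix a assume a: "a \<in> carr ?A"
    show "lip ?M (lact ?M a m) n = vmult ?A a (lip ?M m n)"
      using lact[OF a mn'(1)] by (intro A_eqI) (simp add: sel selM lip mn')
    show "rip ?M m (ract ?M n a) = vmult ?A (rip ?M m n) a"
    proof -
      have an: "ract ?M n a \<in> carr ?X" using ract a mn' by simp
      have "rip ?X m (ract ?M n a) = vmult ?A (rip ?X m n) (?\<alpha> a)"
        by (rule A_eqI) (use an in \<open>simp add: sel selM rip mn'\<close>)
      thus ?thesis by (simp add: ripM mn' an beta_hom beta_alpha)
    qed
  next
    fix m n p assume mnp: "m \<in> carr ?M" "n \<in> carr ?M" "p \<in> carr ?M"
    note mnp' = mnp[unfolded carrM]
    show "lip ?M (vadd ?M m n) p = vadd ?A (lip ?M m p) (lip ?M n p)"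
      using M.add_closed[OF mnp(1,2)]
      by (intro A_eqI) (simp add: sel carrM selM lip mnp' algebra_simps)
    show "rip ?M m (vadd ?M n p) = vadd ?A (rip ?M m n) (rip ?M m p)"
    proof -
      have np: "vadd ?M n p \<in> carr ?X" using M.add_closed[OF mnp(2,3)] by (simp add: carrM)
      have "rip ?X m (vadd ?M n p) = vadd ?A (rip ?X m n) (rip ?X m p)"
        by (rule A_eqI) (use np in \<open>simp add: sel selM rip mnp' algebra_simps\<close>)
      thus ?thesis by (simp add: ripM mnp' np beta_hom)
    qed
    have "?\<alpha> (rip ?M n p) = rip ?X n p"
      using alpha_alpha_minus mnp' by (simp add: ripM)
    thus "lact ?M (lip ?M m n) p = ract ?M m (rip ?M n p)"
      by (auto simp: selM lip rip mnp')
  next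
    show "complete_wrt ?M (\<lambda>m. sqrt (vnorm ?A (lip ?M m m)))"
    proof (rule compl[of _ "\<lambda>m. lip ?X m m"])
      fix f p assume f: "f \<in> carr ?X"
      show "\<exists>q. cmod (lip ?X f f q) = (cmod (f p))\<^sup>2"
        using ip_sq(1)[OF f] by (metis norm_of_real abs_power2 surj_pair)
    next
      fix f and q :: torus assume f: "f \<in> carr ?X"
      obtain x y where "q = (abs_circle x, y)" using circ by (metis surj_pair)
      thus "\<exists>p. cmod (lip ?X f f q) = (cmod (f p))\<^sup>2"
        using ip_sq(1)[OF f] by (metis norm_of_real abs_power2)
    qed (auto simp: selM lip_A)
    show "complete_wrt ?M (\<lambda>m. sqrt (vnorm ?A (rip ?M m m)))"
    proof (rule compl[of _ "\<lambda>m. rip ?M m m"])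
      fix f and p :: "real \<times> circle" assume f: "f \<in> carr ?X"
      obtain x y where "p = (x, y)" by (metis surj_pair)
      thus "\<exists>q. cmod (rip ?M f f q) = (cmod (f p))\<^sup>2"
        using ip_sq(2)[OF f, of x y] beta[of "rip ?X f f" "abs_circle x" y]
        by (metis norm_of_real abs_power2 ripM[OF f f])
    next
      fix f and q :: torus assume f: "f \<in> carr ?X"
      obtain x y where "fst q + zmul 2 \<mu> = abs_circle x" "snd q + zmul 2 \<nu> = y"
        using circ by (metis surj_pair)
      hence "rip ?M f f q = rip ?X f f (abs_circle x, y)"
        by (auto simp: ripM f alpha_def zmul_minus split: prod.splits)
      thus "\<exists>p. cmod (rip ?M f f q) = (cmod (f p))\<^sup>2"
        using ip_sq(2)[OF f] by (metis norm_of_real abs_power2)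
    qed (auto simp: ripM rip_A alpha_closed)
  qed (auto simp: carrM selM sel alpha_def algebra_simps)
qed


section \<open>The universal property for arbitrary C*-algebras\<close>

context complex_vector_space
begin

lemma add_left_commute: "\<lbrakk>x \<in> carr V; y \<in> carr V; z \<in> carr V\<rbrakk> \<Longrightarrow>
    vadd V x (vadd V y z) = vadd V y (vadd V x z)"
  by (metis add_assoc add_commute)

lemmas add_ac = add_assoc add_commute add_left_commute

lemma diff_closed: "\<lbrakk>x \<in> carr V; y \<in> carr V\<rbrakk> \<Longrightarrow> vdiff V x y \<in> carr V"
  by (simp add: vdiff_def add_closed scale_closed)

lemma diff_add: "\<lbrakk>x \<in> carr V; y \<in> carr V; z \<in> carr V; w \<in> carr V\<rbrakk> \<Longrightarrow>
    vdiff V (vadd V x y) (vadd V z w) = vadd V (vdiff V x z) (vdiff V y w)"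
  by (simp add: vdiff_def scale_add_right add_ac add_closed scale_closed)

lemma diff_scale: "\<lbrakk>x \<in> carr V; y \<in> carr V\<rbrakk> \<Longrightarrow>
    vdiff V (vscale V k x) (vscale V k y) = vscale V k (vdiff V x y)"
  by (simp add: vdiff_def scale_add_right scale_scale scale_closed)

lemma add_diff_cancel: "\<lbrakk>x \<in> carr V; y \<in> carr V\<rbrakk> \<Longrightarrow> vadd V (vdiff V x y) y = x"
proof -
  assume *: "x \<in> carr V" "y \<in> carr V"
  have "vadd V (vdiff V x y) y = vadd V x (vdiff V y y)"
    using * by (simp add: vdiff_def add_ac scale_closed add_closed)
  thus ?thesis using * by (simp add: diff_self add_zero)
qed

lemma diff_trans: "\<lbrakk>x \<in> carr V; y \<in> carr V; z \<in> carr V\<rbrakk> \<Longrightarrow>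
    vdiff V x z = vadd V (vdiff V x y) (vdiff V y z)"
proof -
  assume *: "x \<in> carr V" "y \<in> carr V" "z \<in> carr V"
  have "vdiff V x z = vdiff V (vadd V (vdiff V x y) y) z" using * by (simp add: add_diff_cancel)
  also have "\<dots> = vadd V (vdiff V x y) (vdiff V y z)"
    using * unfolding vdiff_def[of V _ z] by (simp add: add_assoc diff_closed scale_closed)
  finally show ?thesis .
qed

lemma diff_swap: "\<lbrakk>x \<in> carr V; y \<in> carr V\<rbrakk> \<Longrightarrow> vdiff V x y = vscale V (-1) (vdiff V y x)"
  by (simp add: vdiff_def scale_add_right scale_scale scale_one scale_closed add_commute)

lemma diff_eq_zero: "\<lbrakk>x \<in> carr V; y \<in> carr V; vdiff V x y = vzero V\<rbrakk> \<Longrightarrow> x = y"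
  by (metis add_commute add_diff_cancel add_zero zero_closed)

lemma scale_zero: "x \<in> carr V \<Longrightarrow> vscale V 0 x = vzero V"
  using scale_add_left[of x 1 "-1"] diff_self[of x] by (simp add: scale_one vdiff_def)

end

context cstar_algebra
begin

definition lim_to :: "(nat \<Rightarrow> 'b) \<Rightarrow> 'b \<Rightarrow> bool"
  where "lim_to s x \<longleftrightarrow> (\<lambda>n. vnorm B (vdiff B (s n) x)) \<longlonglongrightarrow> 0"

lemma norm_diff_swap: "\<lbrakk>x \<in> carr B; y \<in> carr B\<rbrakk> \<Longrightarrow> vnorm B (vdiff B x y) = vnorm B (vdiff B y x)"
  by (subst diff_swap) (simp_all add: norm_scale diff_closed)

lemma norm_diff_triangle: "\<lbrakk>x \<in> carr B; y \<in> carr B; z \<in> carr B\<rbrakk> \<Longrightarrow>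
    vnorm B (vdiff B x z) \<le> vnorm B (vdiff B x y) + vnorm B (vdiff B y z)"
  by (subst diff_trans[of x y z]) (simp_all add: norm_triangle diff_closed)

lemma norm_star: "x \<in> carr B \<Longrightarrow> vnorm B (vstar B x) = vnorm B x"
proof -
  have le: "vnorm B y \<le> vnorm B (vstar B y)" if "y \<in> carr B" for y
  proof (cases "vnorm B y = 0")
    case True
    thus ?thesis using that by (simp add: norm_nonneg star_closed)
  next
    case False
    have "vnorm B y * vnorm B y \<le> vnorm B (vstar B y) * vnorm B y"
      using cstar_identity[OF that] norm_mult[OF star_closed[OF that] that]
      by (simp add: power2_eq_square)
    thus ?thesis using False norm_nonneg[OF that] by (simp add: mult_le_cancel_right)
  qed
  assume x: "x \<in> carr B"
  from le[OF x] le[OF star_closed[OF x]] x show ?thesis by (simp add: star_star)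
qed

lemma lim_toI:
  assumes "\<And>n. s n \<in> carr B" "x \<in> carr B"
    and "\<And>n. vnorm B (vdiff B (s n) x) \<le> r n" "r \<longlonglongrightarrow> 0"
  shows "lim_to s x"
  unfolding lim_to_def
  by (rule tendsto_sandwich[OF _ _ tendsto_const assms(4)])
    (auto simp: assms norm_nonneg diff_closed)

lemma lim_to_unique:
  assumes "\<And>n. s n \<in> carr B" "x \<in> carr B" "y \<in> carr B" "lim_to s x" "lim_to s y"
  shows "x = y"
proof -
  have "(\<lambda>n. vnorm B (vdiff B (s n) x) + vnorm B (vdiff B (s n) y)) \<longlonglongrightarrow> 0 + 0"
    using assms(4,5) unfolding lim_to_def by (rule tendsto_add)
  moreover have "vnorm B (vdiff B x y) \<le> vnorm B (vdiff B (s n) x) + vnorm B (vdiff B (s n) y)" for n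
    using norm_diff_triangle[of x "s n" y] norm_diff_swap[of x "s n"] assms(1-3) by simp
  ultimately have "vnorm B (vdiff B x y) \<le> 0 + 0" by (intro LIMSEQ_le_const) auto
  hence "vnorm B (vdiff B x y) \<le> 0" by simp
  moreover have c: "vdiff B x y \<in> carr B" using assms(2,3) by (rule diff_closed)
  ultimately have "vnorm B (vdiff B x y) = 0" using norm_nonneg[OF c] by linarith
  hence "vdiff B x y = vzero B" using norm_eq_zero[OF c] by simp
  thus ?thesis using assms(2,3) by (rule diff_eq_zero[rotated 2])
qed

lemma lim_to_add:
  assumes "\<And>n. s n \<in> carr B" "\<And>n. t n \<in> carr B" "x \<in> carr B" "y \<in> carr B"
    "lim_to s x" "lim_to t y"
  shows "lim_to (\<lambda>n. vadd B (s n) (t n)) (vadd B x y)"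
proof (rule lim_toI)
  show "(\<lambda>n. vnorm B (vdiff B (s n) x) + vnorm B (vdiff B (t n) y)) \<longlonglongrightarrow> 0"
    using tendsto_add[of _ 0 _ _ 0] assms(5,6) unfolding lim_to_def by fastforce
qed (simp_all add: assms add_closed diff_add norm_triangle diff_closed)

lemma lim_to_scale:
  assumes "\<And>n. s n \<in> carr B" "x \<in> carr B" "lim_to s x"
  shows "lim_to (\<lambda>n. vscale B k (s n)) (vscale B k x)"
proof (rule lim_toI)
  show "(\<lambda>n. cmod k * vnorm B (vdiff B (s n) x)) \<longlonglongrightarrow> 0"
    using assms(3) tendsto_mult_right_zero unfolding lim_to_def by blast
qed (simp_all add: assms scale_closed diff_scale norm_scale diff_closed)

lemma star_diff: "\<lbrakk>x \<in> carr B; y \<in> carr B\<rbrakk> \<Longrightarrow> vdiff B (vstar B x) (vstar B y) = vstar B (vdiff B x y)"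
  by (simp add: vdiff_def star_add star_scale scale_closed)

lemma lim_to_star:
  assumes "\<And>n. s n \<in> carr B" "x \<in> carr B" "lim_to s x"
  shows "lim_to (\<lambda>n. vstar B (s n)) (vstar B x)"
  using assms by (simp add: lim_to_def star_diff norm_star diff_closed)

lemma lim_to_mult:
  assumes "\<And>n. s n \<in> carr B" "\<And>n. t n \<in> carr B" "x \<in> carr B" "y \<in> carr B"
    "lim_to s x" "lim_to t y"
  shows "lim_to (\<lambda>n. vmult B (s n) (t n)) (vmult B x y)"
proof (rule lim_toI)
  let ?a = "\<lambda>n. vnorm B (vdiff B (s n) x)" and ?b = "\<lambda>n. vnorm B (vdiff B (t n) y)"
  have "(\<lambda>n. ?a n * (?b n + vnorm B y) + vnorm B x * ?b n) \<longlonglongrightarrow> 0 * (0 + vnorm B y) + vnorm B x * 0"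
    using assms(5,6) unfolding lim_to_def by (intro tendsto_intros)
  thus "(\<lambda>n. ?a n * (?b n + vnorm B y) + vnorm B x * ?b n) \<longlonglongrightarrow> 0" by simp
  fix n
  note c = assms(1)[of n] assms(2)[of n] assms(3,4)
  have d1: "vdiff B (vmult B (s n) (t n)) (vmult B x (t n)) = vmult B (vdiff B (s n) x) (t n)"
    and d2: "vdiff B (vmult B x (t n)) (vmult B x y) = vmult B x (vdiff B (t n) y)"
    using c by (simp_all add: vdiff_def mult_add_left mult_add_right mult_scale_left
        mult_scale_right scale_closed)
  have "vnorm B (t n) \<le> ?b n + vnorm B y"
    using norm_triangle[OF diff_closed[OF c(2,4)] c(4)] by (simp add: add_diff_cancel c)
  moreover have "vnorm B (vdiff B (vmult B (s n) (t n)) (vmult B x y)) \<le>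
      vnorm B (vmult B (vdiff B (s n) x) (t n)) + vnorm B (vmult B x (vdiff B (t n) y))"
    using norm_diff_triangle[of "vmult B (s n) (t n)" "vmult B x (t n)" "vmult B x y"] c
    by (simp add: mult_closed d1 d2)
  moreover have "vnorm B (vmult B (vdiff B (s n) x) (t n)) \<le> ?a n * vnorm B (t n)"
    "vnorm B (vmult B x (vdiff B (t n) y)) \<le> vnorm B x * ?b n"
    using c by (simp_all add: norm_mult diff_closed)
  moreover have "0 \<le> ?a n" using c by (simp add: norm_nonneg diff_closed)
  ultimately show "vnorm B (vdiff B (vmult B (s n) (t n)) (vmult B x y)) \<le>
      ?a n * (?b n + vnorm B y) + vnorm B x * ?b n"
    using mult_left_mono[of "vnorm B (t n)" "?b n + vnorm B y" "?a n"] by linarith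
qed (simp_all add: assms mult_closed)

lemma subalgebra:
  assumes S: "S \<subseteq> carr B" "vzero B \<in> S" "\<And>x y. x \<in> S \<Longrightarrow> y \<in> S \<Longrightarrow> vadd B x y \<in> S"
    "\<And>k x. x \<in> S \<Longrightarrow> vscale B k x \<in> S" "\<And>x y. x \<in> S \<Longrightarrow> y \<in> S \<Longrightarrow> vmult B x y \<in> S"
    "\<And>x. x \<in> S \<Longrightarrow> vstar B x \<in> S"
    and closed: "\<And>s x. range s \<subseteq> S \<Longrightarrow> x \<in> carr B \<Longrightarrow> lim_to s x \<Longrightarrow> x \<in> S"
  shows "cstar_algebra (B\<lparr>carr := S\<rparr>)"
proof -
  have sc: "x \<in> carr B" if "x \<in> S" for x using that S(1) by blast
  have d: "vdiff (B\<lparr>carr := S\<rparr>) = vdiff B" by (simp add: vdiff_def fun_eq_iff)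
  have "complete_wrt (B\<lparr>carr := S\<rparr>) (vnorm B)"
    unfolding complete_wrt_def
  proof (intro allI impI, elim conjE)
    fix s :: "nat \<Rightarrow> 'b" assume s: "range s \<subseteq> carr (B\<lparr>carr := S\<rparr>)"
      and C: "\<forall>e>0. \<exists>n0. \<forall>m\<ge>n0. \<forall>n\<ge>n0. vnorm B (vdiff (B\<lparr>carr := S\<rparr>) (s m) (s n)) < e"
    have sS: "range s \<subseteq> S" using s by simp
    hence "range s \<subseteq> carr B" using S(1) by (rule order_trans)
    with C[unfolded d] complete[unfolded complete_wrt_def, THEN spec, of s]
    obtain l where l: "l \<in> carr B" "(\<lambda>n. vnorm B (vdiff B (s n) l)) \<longlonglongrightarrow> 0"
      by auto
    moreover have "l \<in> S" using closed[OF sS l(1)] l(2) by (simp add: lim_to_def)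
    ultimately show "\<exists>l\<in>carr (B\<lparr>carr := S\<rparr>). (\<lambda>n. vnorm B (vdiff (B\<lparr>carr := S\<rparr>) (s n) l)) \<longlonglongrightarrow> 0"
      unfolding d by auto
  qed
  moreover have "complex_vector_space (B\<lparr>carr := S\<rparr>)"
    by standard (simp_all add: d S sc add_ac add_zero diff_self scale_add_right
        scale_add_left scale_scale scale_one)
  ultimately show ?thesis
    by (intro cstar_algebra.intro cstar_algebra_axioms.intro)
      (simp_all add: S sc mult_assoc mult_add_left mult_add_right mult_scale_left mult_scale_right
        star_star star_add star_scale star_mult norm_nonneg norm_eq_zero norm_triangle norm_scale
        norm_mult cstar_identity)
qed

end

primrec poly_eval :: "'b cstar \<Rightarrow> ('p \<Rightarrow> 'b) \<Rightarrow> ('q \<Rightarrow> 'b) \<Rightarrow> ('p, 'q) star_poly \<Rightarrow> 'b" where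
  "poly_eval B g h (GenA a) = g a"
| "poly_eval B g h (GenM m) = h m"
| "poly_eval B g h (Plus p q) = vadd B (poly_eval B g h p) (poly_eval B g h q)"
| "poly_eval B g h (Scale k p) = vscale B k (poly_eval B g h p)"
| "poly_eval B g h (Times p q) = vmult B (poly_eval B g h p) (poly_eval B g h q)"
| "poly_eval B g h (Adj p) = vstar B (poly_eval B g h p)"

lemma generated_subalgebra_embeds:
  fixes B :: "'b cstar" and g :: "'p \<Rightarrow> 'b" and h :: "'q \<Rightarrow> 'b"
  assumes "cstar_algebra B" and gh: "range g \<subseteq> carr B" "range h \<subseteq> carr B"
  obtains S and \<iota> :: "'b \<Rightarrow> nat \<Rightarrow> ('p, 'q) star_poly"
  where "S \<subseteq> carr B" "cstar_algebra (B\<lparr>carr := S\<rparr>)" "range g \<subseteq> S" "range h \<subseteq> S" "inj_on \<iota> S"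
proof -
  interpret cstar_algebra B by fact
  let ?E = "poly_eval B g h"
  have E: "?E p \<in> carr B" for p
    using gh by (induction p) (auto simp: add_closed scale_closed mult_closed star_closed)
  define S where "S = {x \<in> carr B. \<exists>s. lim_to (\<lambda>n. ?E (s n)) x}"
  have SI: "x \<in> S" if "lim_to (\<lambda>n. ?E (s n)) x" "x \<in> carr B" for s x
    using that by (auto simp: S_def)
  have ES: "?E p \<in> S" for p
    using norm_eq_zero[OF zero_closed]
    by (intro SI[of "\<lambda>_. p"]) (simp_all add: E lim_to_def diff_self)
  have "cstar_algebra (B\<lparr>carr := S\<rparr>)"
  proof (rule subalgebra)
    show "S \<subseteq> carr B" by (auto simp: S_def)
    show "vzero B \<in> S" using ES[of "Scale 0 (GenA undefined)"] gh by (simp add: scale_zero image_subset_iff)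
    fix x assume "x \<in> S"
    then obtain s where x: "x \<in> carr B" "lim_to (\<lambda>n. ?E (s n)) x" by (auto simp: S_def)
    show "vscale B k x \<in> S" for k
      using SI[of "\<lambda>n. Scale k (s n)"] lim_to_scale[OF E x] x by (simp add: scale_closed)
    show "vstar B x \<in> S"
      using SI[of "\<lambda>n. Adj (s n)"] lim_to_star[OF E x] x by (simp add: star_closed)
    fix y assume "y \<in> S"
    then obtain t where y: "y \<in> carr B" "lim_to (\<lambda>n. ?E (t n)) y" by (auto simp: S_def)
    show "vadd B x y \<in> S"
      using SI[of "\<lambda>n. Plus (s n) (t n)"] lim_to_add[OF E E x(1) y(1) x(2) y(2)] x y
      by (simp add: add_closed)
    show "vmult B x y \<in> S"
      using SI[of "\<lambda>n. Times (s n) (t n)"] lim_to_mult[OF E E x(1) y(1) x(2) y(2)] x y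
      by (simp add: mult_closed)
  next
    fix u x assume u: "range u \<subseteq> S" and x: "x \<in> carr B" "lim_to u x"
    have uB: "u n \<in> carr B" for n using u by (auto simp: S_def)
    have "\<exists>p. vnorm B (vdiff B (?E p) (u n)) < inverse (real (Suc n))" for n
    proof -
      obtain s where "lim_to (\<lambda>k. ?E (s k)) (u n)" using u by (auto simp: S_def)
      from LIMSEQ_D[OF this[unfolded lim_to_def], of "inverse (real (Suc n))"]
      obtain N where "\<forall>k\<ge>N. norm (vnorm B (vdiff B (?E (s k)) (u n)) - 0) < inverse (real (Suc n))"
        by auto
      hence "vnorm B (vdiff B (?E (s N)) (u n)) < inverse (real (Suc n))" by auto
      thus ?thesis by blast
    qed
    then obtain p where p: "\<And>n. vnorm B (vdiff B (?E (p n)) (u n)) < inverse (real (Suc n))" by metis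
    have "lim_to (\<lambda>n. ?E (p n)) x"
    proof (rule lim_toI)
      show "(\<lambda>n. inverse (real (Suc n)) + vnorm B (vdiff B (u n) x)) \<longlonglongrightarrow> 0"
        using tendsto_add[OF LIMSEQ_inverse_real_of_nat x(2)[unfolded lim_to_def]] by simp
      show "vnorm B (vdiff B (?E (p n)) x) \<le> inverse (real (Suc n)) + vnorm B (vdiff B (u n) x)" for n
        using norm_diff_triangle[OF E uB x(1), of "p n" n] p[of n] by simp
    qed (simp_all add: E x)
    thus "x \<in> S" using x(1) by (rule SI)
  qed
  moreover have "inj_on (\<lambda>x. SOME s. lim_to (\<lambda>n. ?E (s n)) x) S" (is "inj_on ?\<iota> S")
  proof (rule inj_onI)
    fix x y assume x: "x \<in> S" and y: "y \<in> S" and eq: "?\<iota> x = ?\<iota> y"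
    have *: "lim_to (\<lambda>n. ?E (?\<iota> z n)) z" if "z \<in> S" for z
    proof -
      have "\<exists>s. lim_to (\<lambda>n. ?E (s n)) z" using that by (simp add: S_def)
      thus ?thesis by (rule someI_ex)
    qed
    have "lim_to (\<lambda>n. ?E (?\<iota> x n)) y" unfolding eq by (rule *[OF y])
    moreover have "x \<in> carr B" "y \<in> carr B" using x y by (simp_all add: S_def)
    ultimately show "x = y" using lim_to_unique[OF E _ _ *[OF x]] by blast
  qed
  moreover have "range g \<subseteq> S"
  proof (rule image_subsetI)
    show "g a \<in> S" for a using ES[of "GenA a"] by simp
  qed
  moreover have "range h \<subseteq> S"
  proof (rule image_subsetI)
    show "h a \<in> S" for a using ES[of "GenM a"] by simp
  qed
  moreover have "S \<subseteq> carr B" by (simp add: S_def Collect_restrict)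
  ultimately show ?thesis by (intro that)
qed

definition transport :: "('b \<Rightarrow> 'c) \<Rightarrow> 'b cstar \<Rightarrow> 'c cstar"
  where "transport \<iota> B = (let \<kappa> = inv_into (carr B) \<iota> in
    \<lparr>carr = \<iota> ` carr B, vzero = \<iota> (vzero B), vadd = \<lambda>x y. \<iota> (vadd B (\<kappa> x) (\<kappa> y)),
     vscale = \<lambda>k x. \<iota> (vscale B k (\<kappa> x)), vmult = \<lambda>x y. \<iota> (vmult B (\<kappa> x) (\<kappa> y)),
     vstar = \<lambda>x. \<iota> (vstar B (\<kappa> x)), vnorm = \<lambda>x. vnorm B (\<kappa> x)\<rparr>)"

lemma transport:
  fixes B :: "'b cstar" and \<iota> :: "'b \<Rightarrow> 'c"
  assumes "cstar_algebra B" and inj: "inj_on \<iota> (carr B)"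
  shows "cstar_algebra (transport \<iota> B)" "star_hom B (transport \<iota> B) \<iota>"
    "star_hom (transport \<iota> B) B (inv_into (carr B) \<iota>)"
proof -
  interpret cstar_algebra B by fact
  let ?C = "transport \<iota> B" and ?\<kappa> = "inv_into (carr B) \<iota>"
  have k [simp]: "?\<kappa> (\<iota> x) = x" if "x \<in> carr B" for x using inj that by simp
  have sel: "carr ?C = \<iota> ` carr B" "vzero ?C = \<iota> (vzero B)"
    "\<And>x y. vadd ?C x y = \<iota> (vadd B (?\<kappa> x) (?\<kappa> y))" "\<And>c x. vscale ?C c x = \<iota> (vscale B c (?\<kappa> x))"
    "\<And>x y. vmult ?C x y = \<iota> (vmult B (?\<kappa> x) (?\<kappa> y))" "\<And>x. vstar ?C x = \<iota> (vstar B (?\<kappa> x))"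
    "\<And>x. vnorm ?C x = vnorm B (?\<kappa> x)"
    by (simp_all add: transport_def Let_def)
  note cl = zero_closed add_closed scale_closed mult_closed star_closed
  have d: "vdiff ?C (\<iota> x) (\<iota> y) = \<iota> (vdiff B x y)" if "x \<in> carr B" "y \<in> carr B" for x y
    using that by (simp add: vdiff_def sel cl)
  have inj': "\<iota> x = \<iota> y \<longleftrightarrow> x = y" if "x \<in> carr B" "y \<in> carr B" for x y
    using inj that by (auto dest: inj_onD)
  have cvs: "complex_vector_space ?C"
  proof
    fix x assume "x \<in> carr ?C"
    thus "vdiff ?C x x = vzero ?C" by (auto simp: sel(1,2) d diff_self)
    fix y assume "y \<in> carr ?C"
    thus "vadd ?C x y = vadd ?C y x" using \<open>x \<in> carr ?C\<close> by (auto simp: sel(1,3) add_commute)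
  qed (auto simp: sel cl add_assoc add_zero scale_add_right scale_add_left scale_scale scale_one)
  have compl: "complete_wrt ?C (vnorm ?C)"
    unfolding complete_wrt_def
  proof (intro allI impI, elim conjE)
    fix s :: "nat \<Rightarrow> 'c" assume s: "range s \<subseteq> carr ?C"
      and C: "\<forall>e>0. \<exists>n0. \<forall>m\<ge>n0. \<forall>n\<ge>n0. vnorm ?C (vdiff ?C (s m) (s n)) < e"
    define t where "t n = ?\<kappa> (s n)" for n
    have st: "s n = \<iota> (t n)" "t n \<in> carr B" for n
      using s by (auto simp: sel t_def f_inv_into_f inv_into_into image_subset_iff)
    have "\<forall>e>0. \<exists>n0. \<forall>m\<ge>n0. \<forall>n\<ge>n0. vnorm B (vdiff B (t m) (t n)) < e"
      using C by (simp add: st d sel(7) diff_closed)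
    moreover have "range t \<subseteq> carr B" using st by auto
    ultimately obtain l where l: "l \<in> carr B" "(\<lambda>n. vnorm B (vdiff B (t n) l)) \<longlonglongrightarrow> 0"
      using complete unfolding complete_wrt_def by blast
    show "\<exists>l\<in>carr ?C. (\<lambda>n. vnorm ?C (vdiff ?C (s n) l)) \<longlonglongrightarrow> 0"
      using l by (intro bexI[of _ "\<iota> l"]) (simp_all add: sel(1,7) st d diff_closed)
  qed
  show "cstar_algebra ?C"
  proof (intro cstar_algebra.intro cstar_algebra_axioms.intro)
    show "complex_vector_space ?C" "complete_wrt ?C (vnorm ?C)" by fact+
  qed (auto simp: sel cl inj' mult_assoc mult_add_left mult_add_right mult_scale_left
      mult_scale_right star_star star_add star_scale star_mult norm_nonneg norm_eq_zero
      norm_triangle norm_scale norm_mult cstar_identity)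
  show "star_hom B ?C \<iota>" "star_hom ?C B ?\<kappa>"
    by (auto simp: star_hom_def linear_on_carr_def sel cl)
qed

lemma star_hom_comp:
  assumes "star_hom B C f" "star_hom C E g" shows "star_hom B E (g \<circ> f)"
  using assms unfolding star_hom_def linear_on_carr_def image_subset_iff by simp

lemma covariant_pair_comp:
  assumes "cstar_algebra B" "covariant_pair A M B jA jM" "star_hom B C f"
  shows "covariant_pair A M C (f \<circ> jA) (f \<circ> jM)"
proof -
  interpret cstar_algebra B by fact
  have jA: "star_hom A B jA" and cl: "\<And>m. m \<in> carr M \<Longrightarrow> jM m \<in> carr B"
    and cl': "\<And>a. a \<in> carr A \<Longrightarrow> jA a \<in> carr B"
    using assms(2) by (auto simp: covariant_pair_def star_hom_def linear_on_carr_def)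
  have f: "\<And>x y. x \<in> carr B \<Longrightarrow> y \<in> carr B \<Longrightarrow> f (vmult B x y) = vmult C (f x) (f y)"
    "\<And>x y. x \<in> carr B \<Longrightarrow> y \<in> carr B \<Longrightarrow> f (vadd B x y) = vadd C (f x) (f y)"
    "\<And>x. x \<in> carr B \<Longrightarrow> f (vstar B x) = vstar C (f x)" "\<And>x. x \<in> carr B \<Longrightarrow> f x \<in> carr C"
    "\<And>k x. x \<in> carr B \<Longrightarrow> f (vscale B k x) = vscale C k (f x)"
    using assms(3) by (auto simp: star_hom_def linear_on_carr_def)
  show ?thesis
    unfolding covariant_pair_def
  proof (intro conjI ballI)
    show "star_hom A C (f \<circ> jA)" using star_hom_comp[OF jA assms(3)] .
    show "linear_on_carr M C (f \<circ> jM)"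
      using assms(2) by (auto simp: covariant_pair_def linear_on_carr_def f cl)
  next
    fix m n assume mn: "m \<in> carr M" "n \<in> carr M"
    have "f (vmult B (jM m) (vstar B (jM n))) = f (jA (lip M m n))"
      "f (vmult B (vstar B (jM m)) (jM n)) = f (jA (rip M m n))"
      using assms(2) mn by (simp_all add: covariant_pair_def)
    thus "vmult C ((f \<circ> jM) m) (vstar C ((f \<circ> jM) n)) = (f \<circ> jA) (lip M m n)"
      "vmult C (vstar C ((f \<circ> jM) m)) ((f \<circ> jM) n) = (f \<circ> jA) (rip M m n)"
      using mn by (simp_all add: f cl star_closed)
  qed (use assms(2) in \<open>simp_all add: covariant_pair_def f cl cl'\<close>)
qed

lemma star_hom_restrict:
  assumes "star_hom A B f" "f ` carr A \<subseteq> S"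
  shows "star_hom A (B\<lparr>carr := S\<rparr>) f"
  using assms by (simp add: star_hom_def linear_on_carr_def)

lemma star_hom_unrestrict:
  assumes "star_hom A (B\<lparr>carr := S\<rparr>) f" "S \<subseteq> carr B"
  shows "star_hom A B f"
  using assms by (auto simp: star_hom_def linear_on_carr_def)

lemma covariant_pair_restrict:
  assumes "covariant_pair A M B jA jM" "jA ` carr A \<subseteq> S" "jM ` carr M \<subseteq> S"
  shows "covariant_pair A M (B\<lparr>carr := S\<rparr>) jA jM"
  using assms by (auto simp: covariant_pair_def star_hom_def linear_on_carr_def)

primrec flatten_poly :: "(('a, 'm) star_poly, ('a, 'm) star_poly) star_poly \<Rightarrow> ('a, 'm) star_poly" where
  "flatten_poly (GenA p) = Scale 0 p"
| "flatten_poly (GenM p) = Scale 1 p"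
| "flatten_poly (Plus p q) = Plus (flatten_poly p) (flatten_poly q)"
| "flatten_poly (Scale k p) = Adj (Scale k (flatten_poly p))"
| "flatten_poly (Times p q) = Times (flatten_poly p) (flatten_poly q)"
| "flatten_poly (Adj p) = Adj (Plus (flatten_poly p) (flatten_poly p))"

lemma flatten_poly_inj: "flatten_poly p = flatten_poly q \<Longrightarrow> p = q"
proof (induction p arbitrary: q)
  case (GenA x) thus ?case by (cases q) auto
next
  case (GenM x) thus ?case by (cases q) auto
next
  case (Plus p1 p2) thus ?case by (cases q) auto
next
  case (Scale x1a p) thus ?case by (cases q) auto
next
  case (Times p1 p2) thus ?case by (cases q) auto
next
  case (Adj p) thus ?case by (cases q) auto
qed

lemma map_star_poly_eval_inj:
  "(\<And>m. map_star_poly (\<lambda>u. u m) (\<lambda>u. u m) p = map_star_poly (\<lambda>u. u m) (\<lambda>u. u m) q) \<Longrightarrow> p = q"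
proof (induction p arbitrary: q)
  case (GenA x) thus ?case by (cases q) (auto simp: fun_eq_iff)
next
  case (GenM x) thus ?case by (cases q) (auto simp: fun_eq_iff)
next
  case (Plus p1 p2) thus ?case by (cases q) auto
next
  case (Scale x1a p) thus ?case by (cases q) auto
next
  case (Times p1 p2) thus ?case by (cases q) auto
next
  case (Adj p) thus ?case by (cases q) auto
qed

definition flatten_univ ::
    "(('a, 'm) cp_univ, ('a, 'm) cp_univ) cp_univ \<Rightarrow> ('a, 'm) cp_univ"
  where "flatten_univ s k = (let (n, m) = prod_decode k in
    flatten_poly (map_star_poly (\<lambda>u. u m) (\<lambda>u. u m) (s n)))"

lemma flatten_univ_inj: "inj flatten_univ"
proof (rule injI, rule ext)
  fix s t n assume eq: "flatten_univ s = flatten_univ t"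
  show "s n = t n"
  proof (rule map_star_poly_eval_inj)
    fix m
    show "map_star_poly (\<lambda>u. u m) (\<lambda>u. u m) (s n) = map_star_poly (\<lambda>u. u m) (\<lambda>u. u m) (t n)"
      using fun_cong[OF eq, of "prod_encode (n, m)"] by (simp add: flatten_univ_def flatten_poly_inj)
  qed
qed

lemma image_subset_extend:
  assumes "range (\<lambda>x. if x \<in> X then f x else z) \<subseteq> S" shows "f ` X \<subseteq> S"
proof (rule image_subsetI)
  fix x assume "x \<in> X"
  moreover have "(if x \<in> X then f x else z) \<in> S" using assms by blast
  ultimately show "f x \<in> S" by simp
qed

lemma universal_property_any_type:
  fixes B :: "'b cstar" and M :: "('a, 'm) bimod"
  assumes D: "cstar_algebra D" "covariant_pair A M D iA iM"
      "generates (iA ` carr A \<union> iM ` carr M) D"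
    and univ: "\<And>(B :: ('a, 'm) cp_univ cstar) jA jM. cstar_algebra B \<Longrightarrow>
      covariant_pair A M B jA jM \<Longrightarrow> factors_uniquely A M D iA iM B jA jM"
    and B: "cstar_algebra B" "covariant_pair A M B jA jM"
  shows "factors_uniquely A M D iA iM B jA jM"
proof -
  interpret D: cstar_algebra D by fact
  interpret B: cstar_algebra B by fact
  have jcl: "\<And>a. a \<in> carr A \<Longrightarrow> jA a \<in> carr B" "\<And>m. m \<in> carr M \<Longrightarrow> jM m \<in> carr B"
    using B(2) by (auto simp: covariant_pair_def star_hom_def linear_on_carr_def)
  have icl: "\<And>a. a \<in> carr A \<Longrightarrow> iA a \<in> carr D" "\<And>m. m \<in> carr M \<Longrightarrow> iM m \<in> carr D"
    using D(2) by (auto simp: covariant_pair_def star_hom_def linear_on_carr_def)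
  have ex: "\<exists>f. factors_via A M D iA iM B jA jM f"
  proof -
    let ?g = "\<lambda>a. if a \<in> carr A then jA a else vzero B"
    let ?h = "\<lambda>m. if m \<in> carr M then jM m else vzero B"
    have gh: "range ?g \<subseteq> carr B" "range ?h \<subseteq> carr B" using jcl B.zero_closed by auto
    obtain S and \<iota> :: "'b \<Rightarrow> ('a, 'm) cp_univ"
      where S: "S \<subseteq> carr B" "cstar_algebra (B\<lparr>carr := S\<rparr>)" "range ?g \<subseteq> S" "range ?h \<subseteq> S"
        and \<iota>: "inj_on \<iota> S"
      using generated_subalgebra_embeds[OF B(1) gh] by blast
    let ?B = "B\<lparr>carr := S\<rparr>"
    have jS: "jA ` carr A \<subseteq> S" "jM ` carr M \<subseteq> S"
      using image_subset_extend[OF S(3)] image_subset_extend[OF S(4)] by simp_all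
    have cov: "covariant_pair A M ?B jA jM" by (rule covariant_pair_restrict[OF B(2) jS])
    have inj: "inj_on \<iota> (carr ?B)" using \<iota> by simp
    note tr = transport[OF S(2) inj]
    let ?\<kappa> = "inv_into (carr ?B) \<iota>"
    have "factors_uniquely A M D iA iM (transport \<iota> ?B) (\<iota> \<circ> jA) (\<iota> \<circ> jM)"
      by (rule univ[OF tr(1) covariant_pair_comp[OF S(2) cov tr(2)]])
    then obtain f where "factors_via A M D iA iM (transport \<iota> ?B) (\<iota> \<circ> jA) (\<iota> \<circ> jM) f"
      unfolding factors_uniquely_def by (elim conjE exE)
    hence f: "star_hom D (transport \<iota> ?B) f"
      "\<And>a. a \<in> carr A \<Longrightarrow> f (iA a) = \<iota> (jA a)" "\<And>m. m \<in> carr M \<Longrightarrow> f (iM m) = \<iota> (jM m)"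
      by (simp_all add: factors_via_def)
    have \<kappa>: "?\<kappa> (\<iota> y) = y" if "y \<in> S" for y using \<iota> that by simp
    have "star_hom D B (?\<kappa> \<circ> f)"
      using star_hom_unrestrict[OF star_hom_comp[OF f(1) tr(3)] S(1)] .
    moreover have "(?\<kappa> \<circ> f) (iA a) = jA a" if "a \<in> carr A" for a
      using f(2)[OF that] \<kappa> jS(1) that by (simp add: image_subset_iff)
    moreover have "(?\<kappa> \<circ> f) (iM m) = jM m" if "m \<in> carr M" for m
      using f(3)[OF that] \<kappa> jS(2) that by (simp add: image_subset_iff)
    ultimately show ?thesis unfolding factors_via_def by blast
  qed
  have unique: "f x = g x"
    if f: "star_hom D B f" "\<forall>a\<in>carr A. f (iA a) = jA a" "\<forall>m\<in>carr M. f (iM m) = jM m"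
      and g: "star_hom D B g" "\<forall>a\<in>carr A. g (iA a) = jA a" "\<forall>m\<in>carr M. g (iM m) = jM m"
      and x: "x \<in> carr D" for f g x
  proof -
    obtain \<delta> :: "_ \<Rightarrow> ('a, 'm) cp_univ" where \<delta>: "inj_on \<delta> (carr D)"
    proof -
      let ?g = "\<lambda>a. if a \<in> carr A then iA a else vzero D"
      let ?h = "\<lambda>m. if m \<in> carr M then iM m else vzero D"
      have gh: "range ?g \<subseteq> carr D" "range ?h \<subseteq> carr D" using icl D.zero_closed by auto
      obtain S and \<iota> :: "_ \<Rightarrow> ('a, 'm) cp_univ"
        where S: "S \<subseteq> carr D" "cstar_algebra (D\<lparr>carr := S\<rparr>)" "range ?g \<subseteq> S" "range ?h \<subseteq> S"
          and \<iota>: "inj_on \<iota> S"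
        using generated_subalgebra_embeds[OF D(1) gh] by blast
        have "iA ` carr A \<subseteq> S" "iM ` carr M \<subseteq> S"
        using image_subset_extend[OF S(3)] image_subset_extend[OF S(4)] by simp_all
      hence "iA ` carr A \<union> iM ` carr M \<subseteq> S" by simp
      hence "S = carr D" using D(3) S unfolding generates_def by blast
      thus ?thesis using \<iota> that by blast
    qed
    have fg: "f y \<in> carr B" "g y \<in> carr B" if "y \<in> carr D" for y
      using f(1) g(1) that by (auto simp: star_hom_def linear_on_carr_def)
    let ?ext = "\<lambda>f u. if u \<in> \<delta> ` carr D then f (inv_into (carr D) \<delta> u) else vzero B"
    have ext: "?ext k (\<delta> y) = k y" if "y \<in> carr D" for k :: "_ \<Rightarrow> 'b" and y
      using \<delta> that by simp
    have "range (?ext f) \<subseteq> carr B" "range (?ext g) \<subseteq> carr B"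
      using \<delta> fg B.zero_closed by auto
    from generated_subalgebra_embeds[OF B(1) this]
    obtain S and \<iota> :: "'b \<Rightarrow> (('a, 'm) cp_univ, ('a, 'm) cp_univ) cp_univ"
      where S: "S \<subseteq> carr B" "cstar_algebra (B\<lparr>carr := S\<rparr>)" "range (?ext f) \<subseteq> S" "range (?ext g) \<subseteq> S"
        and \<iota>: "inj_on \<iota> S" by blast
    let ?B = "B\<lparr>carr := S\<rparr>" and ?\<iota> = "flatten_univ \<circ> \<iota>"
    have inj: "inj_on ?\<iota> (carr ?B)"
      using \<iota> flatten_univ_inj by (auto intro: comp_inj_on inj_on_subset)
    have fS: "f y \<in> S" "g y \<in> S" if "y \<in> carr D" for y
    proof -
      have "?ext f (\<delta> y) \<in> S" "?ext g (\<delta> y) \<in> S" using S(3,4) by blast+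
      thus "f y \<in> S" "g y \<in> S" using ext[OF that] by metis+
    qed
    note tr = transport[OF S(2) inj]
    have hom: "star_hom D ?B f" "star_hom D ?B g"
      by (auto intro!: star_hom_restrict f(1) g(1) fS)
    note hom' = star_hom_comp[OF hom(1) tr(2)] star_hom_comp[OF hom(2) tr(2)]
    have cov: "covariant_pair A M (transport ?\<iota> ?B) ((?\<iota> \<circ> f) \<circ> iA) ((?\<iota> \<circ> f) \<circ> iM)"
      by (rule covariant_pair_comp[OF D(1,2) hom'(1)])
    have "(?\<iota> \<circ> f) x = (?\<iota> \<circ> g) x"
    proof -
      let ?C = "transport ?\<iota> ?B"
      have "factors_via A M D iA iM ?C ((?\<iota> \<circ> f) \<circ> iA) ((?\<iota> \<circ> f) \<circ> iM) (?\<iota> \<circ> f)"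
        unfolding factors_via_def using hom'(1) by simp
      moreover have "factors_via A M D iA iM ?C ((?\<iota> \<circ> f) \<circ> iA) ((?\<iota> \<circ> f) \<circ> iM) (?\<iota> \<circ> g)"
        unfolding factors_via_def using hom'(2) f(2,3) g(2,3) by simp
      ultimately show ?thesis
        using univ[OF tr(1) cov] x unfolding factors_uniquely_def by blast
    qed
    thus ?thesis using inj_onD[OF inj, of "f x" "g x"] fS[OF x] by simp
  qed
  show ?thesis
    unfolding factors_uniquely_def
  proof (intro conjI ex allI impI ballI, elim conjE)
    fix f g x
    assume "factors_via A M D iA iM B jA jM f" "factors_via A M D iA iM B jA jM g" "x \<in> carr D"
    thus "f x = g x" using unique[of f g x] by (simp add: factors_via_def)
  qed
qed

end

(* A covariant pair for a bimodule can be transported along an isomorphism of bimodules, and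
   replacing i_M by its adjoint gives a covariant pair for the conjugate bimodule. Hence
   isomorphic bimodules, and conjugate ones, have isomorphic crossed products. The bimodule of
   D^c_{mu nu} consists of the sections of a line bundle of degree c over the torus, with the right
   action twisted by the translation by 2(mu, nu). An elementary matrix in SL(2,Z) acts on the torus
   by a shear; composing sections with it and correcting by a quadratic phase gives an isomorphism
   between bimodules of the same degree whose translations correspond under the shear. A reflection
   reverses the degree, and so does conjugation, which also inverts the translation; together they
   realise a matrix of determinant -1. *)

theory Submission
  imports Defs
begin

section \<open>Isomorphic bimodules have isomorphic crossed products\<close>

text \<open>A shear of the torus moves the base along with the sections, so a morphism carries its
  own homomorphism \<sigma> between the coefficient algebras.\<close>

definition bimod_morphism ::
    "'a cstar \<Rightarrow> ('a, 'm) bimod \<Rightarrow> 'b cstar \<Rightarrow> ('b, 'n) bimod \<Rightarrow> ('a \<Rightarrow> 'b) \<Rightarrow> ('m \<Rightarrow> 'n) \<Rightarrow> bool"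
  where "bimod_morphism A M B N \<sigma> \<phi> \<longleftrightarrow>
    star_hom A B \<sigma> \<and> linear_on_carr M N \<phi> \<and>
    (\<forall>a\<in>carr A. \<forall>m\<in>carr M. \<phi> (lact M a m) = lact N (\<sigma> a) (\<phi> m)) \<and>
    (\<forall>a\<in>carr A. \<forall>m\<in>carr M. \<phi> (ract M m a) = ract N (\<phi> m) (\<sigma> a)) \<and>
    (\<forall>m\<in>carr M. \<forall>n\<in>carr M. lip N (\<phi> m) (\<phi> n) = \<sigma> (lip M m n)) \<and>
    (\<forall>m\<in>carr M. \<forall>n\<in>carr M. rip N (\<phi> m) (\<phi> n) = \<sigma> (rip M m n))"

definition bimod_isomorphic ::
    "'a cstar \<Rightarrow> ('a, 'm) bimod \<Rightarrow> 'b cstar \<Rightarrow> ('b, 'n) bimod \<Rightarrow> bool"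
  where "bimod_isomorphic A M B N \<longleftrightarrow> (\<exists>\<sigma> \<phi>. bimod_morphism A M B N \<sigma> \<phi> \<and>
    bij_betw \<sigma> (carr A) (carr B) \<and> bij_betw \<phi> (carr M) (carr N))"

lemma linear_on_carr_inv:
  assumes V: "complex_vector_space V" and f: "linear_on_carr V W f"
    and bij: "bij_betw f (carr V) (carr W)"
  shows "linear_on_carr W V (inv_into (carr V) f)"
proof -
  interpret complex_vector_space V by fact
  let ?g = "inv_into (carr V) f"
  have g: "?g x \<in> carr V" "f (?g x) = x" if "x \<in> carr W" for x
    using that bij by (auto simp: bij_betw_def inv_into_into f_inv_into_f)
  have eq: "?g y = x" if "x \<in> carr V" "f x = y" for x y
    using that bij by (auto simp: bij_betw_def)
  show ?thesis
    unfolding linear_on_carr_def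
  proof (intro conjI ballI allI)
    show "?g ` carr W \<subseteq> carr V" using g by blast
    show "?g (vadd W x y) = vadd V (?g x) (?g y)" if "x \<in> carr W" "y \<in> carr W" for x y
      using f that by (intro eq) (simp_all add: add_closed g linear_on_carr_def)
    show "?g (vscale W k x) = vscale V k (?g x)" if "x \<in> carr W" for x k
      using f that by (intro eq) (simp_all add: scale_closed g linear_on_carr_def)
  qed
qed

lemma star_hom_inv:
  assumes A: "cstar_algebra A" and f: "star_hom A B f" and bij: "bij_betw f (carr A) (carr B)"
  shows "star_hom B A (inv_into (carr A) f)"
proof -
  interpret cstar_algebra A by fact
  let ?g = "inv_into (carr A) f"
  have g: "?g x \<in> carr A" "f (?g x) = x" if "x \<in> carr B" for x
    using that bij by (auto simp: bij_betw_def inv_into_into f_inv_into_f)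
  have eq: "?g y = x" if "x \<in> carr A" "f x = y" for x y
    using that bij by (auto simp: bij_betw_def)
  have "linear_on_carr B A ?g"
    using f bij by (intro linear_on_carr_inv complex_vector_space_axioms) (simp_all add: star_hom_def)
  moreover have "?g (vmult B x y) = vmult A (?g x) (?g y)" if "x \<in> carr B" "y \<in> carr B" for x y
    using f that by (intro eq) (simp_all add: mult_closed g star_hom_def)
  moreover have "?g (vstar B x) = vstar A (?g x)" if "x \<in> carr B" for x
    using f that by (intro eq) (simp_all add: star_closed g star_hom_def)
  ultimately show ?thesis by (simp add: star_hom_def)
qed

lemma bimod_morphism_closed:
  assumes "bimod_morphism A M B N \<sigma> \<phi>"
  shows "a \<in> carr A \<Longrightarrow> \<sigma> a \<in> carr B" "m \<in> carr M \<Longrightarrow> \<phi> m \<in> carr N"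
  using assms by (auto simp: bimod_morphism_def star_hom_def linear_on_carr_def)

lemma bimod_morphism_inv:
  assumes M: "hilbert_bimodule A M" and mor: "bimod_morphism A M B N \<sigma> \<phi>"
    and bij: "bij_betw \<sigma> (carr A) (carr B)" "bij_betw \<phi> (carr M) (carr N)"
  shows "bimod_morphism B N A M (inv_into (carr A) \<sigma>) (inv_into (carr M) \<phi>)"
proof -
  interpret hilbert_bimodule A M by fact
  let ?\<tau> = "inv_into (carr A) \<sigma>" and ?\<psi> = "inv_into (carr M) \<phi>"
  have \<tau>: "?\<tau> a \<in> carr A" "\<sigma> (?\<tau> a) = a" if "a \<in> carr B" for a
    using that bij(1) by (auto simp: bij_betw_def inv_into_into f_inv_into_f)
  have \<psi>: "?\<psi> m \<in> carr M" "\<phi> (?\<psi> m) = m" if "m \<in> carr N" for m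
    using that bij(2) by (auto simp: bij_betw_def inv_into_into f_inv_into_f)
  have eq: "?\<tau> b = a" if "a \<in> carr A" "\<sigma> a = b" for a b
    using that bij(1) by (auto simp: bij_betw_def)
  have eq': "?\<psi> n = m" if "m \<in> carr M" "\<phi> m = n" for m n
    using that bij(2) by (auto simp: bij_betw_def)
  show ?thesis
    unfolding bimod_morphism_def
  proof (intro conjI ballI)
    show "star_hom B A ?\<tau>"
      using mor by (intro star_hom_inv A.cstar_algebra_axioms bij) (simp add: bimod_morphism_def)
    show "linear_on_carr N M ?\<psi>"
      using mor by (intro linear_on_carr_inv M.complex_vector_space_axioms bij) (simp add: bimod_morphism_def)
    show "?\<psi> (lact N a m) = lact M (?\<tau> a) (?\<psi> m)" if "a \<in> carr B" "m \<in> carr N" for a m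
      using mor that by (intro eq') (simp_all add: bimod_morphism_def \<tau> \<psi> lact_closed)
    show "?\<psi> (ract N m a) = ract M (?\<psi> m) (?\<tau> a)" if "a \<in> carr B" "m \<in> carr N" for a m
      using mor that by (intro eq') (simp_all add: bimod_morphism_def \<tau> \<psi> ract_closed)
    show "lip M (?\<psi> m) (?\<psi> n) = ?\<tau> (lip N m n)" if "m \<in> carr N" "n \<in> carr N" for m n
    proof -
      have "lip N (\<phi> (?\<psi> m)) (\<phi> (?\<psi> n)) = \<sigma> (lip M (?\<psi> m) (?\<psi> n))"
        using mor that \<psi>(1) unfolding bimod_morphism_def by blast
      thus ?thesis using that by (intro eq[symmetric]) (simp_all add: \<psi> lip_closed)
    qed
    show "rip M (?\<psi> m) (?\<psi> n) = ?\<tau> (rip N m n)" if "m \<in> carr N" "n \<in> carr N" for m n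
    proof -
      have "rip N (\<phi> (?\<psi> m)) (\<phi> (?\<psi> n)) = \<sigma> (rip M (?\<psi> m) (?\<psi> n))"
        using mor that \<psi>(1) unfolding bimod_morphism_def by blast
      thus ?thesis using that by (intro eq[symmetric]) (simp_all add: \<psi> rip_closed)
    qed
  qed
qed

lemma bimod_isomorphic_sym:
  assumes "hilbert_bimodule A M" "bimod_isomorphic A M B N"
  shows "bimod_isomorphic B N A M"
proof -
  obtain \<sigma> \<phi> where f: "bimod_morphism A M B N \<sigma> \<phi>"
    and bij: "bij_betw \<sigma> (carr A) (carr B)" "bij_betw \<phi> (carr M) (carr N)"
    using assms(2) unfolding bimod_isomorphic_def by blast
  show ?thesis
    using bimod_morphism_inv[OF assms(1) f bij] bij_betw_inv_into[OF bij(1)] bij_betw_inv_into[OF bij(2)]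
    unfolding bimod_isomorphic_def by blast
qed

lemma bimod_isomorphic_trans:
  assumes M: "hilbert_bimodule A M"
    and "bimod_isomorphic A M B N" "bimod_isomorphic B N C P"
  shows "bimod_isomorphic A M C P"
proof -
  interpret hilbert_bimodule A M by fact
  obtain \<sigma> \<phi> \<tau> \<psi> where f: "bimod_morphism A M B N \<sigma> \<phi>" and g: "bimod_morphism B N C P \<tau> \<psi>"
    and bij: "bij_betw \<sigma> (carr A) (carr B)" "bij_betw \<phi> (carr M) (carr N)"
      "bij_betw \<tau> (carr B) (carr C)" "bij_betw \<psi> (carr N) (carr P)"
    using assms unfolding bimod_isomorphic_def by blast
  have "star_hom A C (\<tau> \<circ> \<sigma>)"
    using f g by (intro star_hom_comp[of A B \<sigma> C \<tau>]) (simp_all add: bimod_morphism_def)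
  hence "bimod_morphism A M C P (\<tau> \<circ> \<sigma>) (\<psi> \<circ> \<phi>)"
    using f g bimod_morphism_closed[OF f]
    by (simp add: bimod_morphism_def linear_on_carr_def image_subset_iff lip_closed rip_closed)
  thus ?thesis
    using bij_betw_trans[OF bij(1,3)] bij_betw_trans[OF bij(2,4)] unfolding bimod_isomorphic_def by blast
qed

section \<open>Covariant pairs and crossed products along bimodule morphisms\<close>

lemma covariant_pair_pullback:
  assumes "bimod_morphism A M B N \<sigma> \<phi>" "covariant_pair B N E jB jN"
  shows "covariant_pair A M E (jB \<circ> \<sigma>) (jN \<circ> \<phi>)"
  using assms star_hom_comp[of A B \<sigma> E jB] bimod_morphism_closed[OF assms(1)]
  by (simp add: bimod_morphism_def covariant_pair_def linear_on_carr_def image_subset_iff)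

text \<open>The universal property of \<open>D\<close> will be tested against another algebra and
  against \<open>D\<close> itself, which live in different types. An obtained fact is fixed in its
  types, so both instances are delivered together for one and the same pair.\<close>

lemma is_crossed_productE:
  fixes M :: "('a, 'm) bimod"
  assumes "is_crossed_product A M D"
  obtains iA iM where "covariant_pair A M D iA iM"
    "\<And>(B :: 'b cstar) jA jM. cstar_algebra B \<Longrightarrow> covariant_pair A M B jA jM \<Longrightarrow>
      factors_uniquely A M D iA iM B jA jM"
    "\<And>(B :: 'c cstar) jA jM. cstar_algebra B \<Longrightarrow> covariant_pair A M B jA jM \<Longrightarrow>
      factors_uniquely A M D iA iM B jA jM"
proof -
  have D: "cstar_algebra D" using assms by (simp add: is_crossed_product_def)
  obtain iA iM where cov: "covariant_pair A M D iA iM"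
    and gen: "generates (iA ` carr A \<union> iM ` carr M) D"
    and univ: "\<forall>(B :: ('a, 'm) cp_univ cstar) jA jM. cstar_algebra B \<and> covariant_pair A M B jA jM \<longrightarrow>
      factors_uniquely A M D iA iM B jA jM"
    using assms unfolding is_crossed_product_def by (elim conjE exE) (rule that)
  note any = universal_property_any_type[OF D cov gen univ[rule_format, OF conjI]]
  show thesis by (rule that[OF cov any any])
qed

lemma star_hom_id: "star_hom A A id"
  by (simp add: star_hom_def linear_on_carr_def)

text \<open>Uniqueness of universal objects: the pair of \<open>E\<close>, pulled back along
  \<sigma> and \<phi>, factors through \<open>D\<close> and gives \<open>f\<close>; the inverse
  morphism gives \<open>g\<close> in the same way.\<close>

lemma bimod_isomorphic_crossed_product:
  fixes D :: "'d cstar" and E :: "'e cstar"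
  assumes D: "is_crossed_product A M D" and E: "is_crossed_product B N E"
    and iso: "bimod_isomorphic A M B N"
  shows "cstar_isomorphic D E"
proof -
  have alg: "cstar_algebra D" "cstar_algebra E" and M: "hilbert_bimodule A M"
    using D E by (simp_all add: is_crossed_product_def)
  obtain \<sigma> \<phi> where mor: "bimod_morphism A M B N \<sigma> \<phi>"
    and bij: "bij_betw \<sigma> (carr A) (carr B)" "bij_betw \<phi> (carr M) (carr N)"
    using iso unfolding bimod_isomorphic_def by blast
  let ?\<tau> = "inv_into (carr A) \<sigma>" and ?\<psi> = "inv_into (carr M) \<phi>"
  note mor' = bimod_morphism_inv[OF M mor bij]
  have inv: "\<And>a. a \<in> carr A \<Longrightarrow> ?\<tau> (\<sigma> a) = a" "\<And>m. m \<in> carr M \<Longrightarrow> ?\<psi> (\<phi> m) = m"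
    "\<And>b. b \<in> carr B \<Longrightarrow> \<sigma> (?\<tau> b) = b" "\<And>n. n \<in> carr N \<Longrightarrow> \<phi> (?\<psi> n) = n"
    using bij by (auto simp: bij_betw_def f_inv_into_f)
  obtain iA iM where cD: "covariant_pair A M D iA iM"
    and uD: "\<And>(F :: 'e cstar) jA jM. cstar_algebra F \<Longrightarrow> covariant_pair A M F jA jM \<Longrightarrow>
        factors_uniquely A M D iA iM F jA jM"
      "\<And>(F :: 'd cstar) jA jM. cstar_algebra F \<Longrightarrow> covariant_pair A M F jA jM \<Longrightarrow>
        factors_uniquely A M D iA iM F jA jM"
    by (rule is_crossed_productE[OF D]) (rule that)
  obtain iB iN where cE: "covariant_pair B N E iB iN"
    and uE: "\<And>(F :: 'd cstar) jA jM. cstar_algebra F \<Longrightarrow> covariant_pair B N F jA jM \<Longrightarrow>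
        factors_uniquely B N E iB iN F jA jM"
      "\<And>(F :: 'e cstar) jA jM. cstar_algebra F \<Longrightarrow> covariant_pair B N F jA jM \<Longrightarrow>
        factors_uniquely B N E iB iN F jA jM"
    by (rule is_crossed_productE[OF E]) (rule that)
  obtain f where f: "factors_via A M D iA iM E (iB \<circ> \<sigma>) (iN \<circ> \<phi>) f"
    using uD(1)[OF alg(2) covariant_pair_pullback[OF mor cE]] unfolding factors_uniquely_def by blast
  obtain g where g: "factors_via B N E iB iN D (iA \<circ> ?\<tau>) (iM \<circ> ?\<psi>) g"
    using uE(1)[OF alg(1) covariant_pair_pullback[OF mor' cD]] unfolding factors_uniquely_def by blast
  have fg: "star_hom D E f" "star_hom E D g" using f g by (simp_all add: factors_via_def)
  \<comment> \<open>Both \<open>g \<circ> f\<close> and \<open>id\<close> factor the universal pair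
    of \<open>D\<close> through itself, so uniqueness makes them agree on \<open>D\<close>.\<close>
  have "factors_via A M D iA iM D iA iM (g \<circ> f)"
    using f g star_hom_comp[OF fg] bimod_morphism_closed[OF mor]
    by (simp add: factors_via_def inv)
  moreover have "factors_via A M D iA iM D iA iM id" by (simp add: factors_via_def star_hom_id)
  ultimately have gf: "g (f x) = x" if "x \<in> carr D" for x
    using uD(2)[OF alg(1) cD] that unfolding factors_uniquely_def by (metis comp_apply id_apply)
  have "factors_via B N E iB iN E iB iN (f \<circ> g)"
    using f g star_hom_comp[OF fg(2,1)] bimod_morphism_closed[OF mor']
    by (simp add: factors_via_def inv)
  moreover have "factors_via B N E iB iN E iB iN id" by (simp add: factors_via_def star_hom_id)
  ultimately have fg': "f (g x) = x" if "x \<in> carr E" for x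
    using uE(2)[OF alg(2) cE] that unfolding factors_uniquely_def by (metis comp_apply id_apply)
  have "bij_betw f (carr D) (carr E)"
    using fg gf fg' by (intro bij_betwI[where g = g]) (auto simp: star_hom_def linear_on_carr_def)
  thus ?thesis using fg(1) unfolding cstar_isomorphic_def by blast
qed

section \<open>The conjugate bimodule\<close>

text \<open>This is the dual bimodule. The inner products change sides without an adjoint:
  \<open>rip M\<close> is conjugate-linear in its first variable, hence linear there for the
  conjugate scalars.\<close>

definition conj_bimod :: "'a cstar \<Rightarrow> ('a, 'm) bimod \<Rightarrow> ('a, 'm) bimod"
  where "conj_bimod A M = \<lparr>carr = carr M, vzero = vzero M, vadd = vadd M,
    vscale = (\<lambda>k. vscale M (cnj k)),
    lact = (\<lambda>a m. ract M m (vstar A a)), ract = (\<lambda>m a. lact M (vstar A a) m),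
    lip = rip M, rip = lip M\<rparr>"

lemma hilbert_bimodule_conj:
  assumes "hilbert_bimodule A M" shows "hilbert_bimodule A (conj_bimod A M)"
proof -
  interpret hilbert_bimodule A M by fact
  let ?N = "conj_bimod A M"
  have diff: "vdiff ?N = vdiff M" by (simp add: conj_bimod_def vdiff_def fun_eq_iff)
  have vs: "complex_vector_space ?N"
    by standard (simp_all add: diff, simp_all add: conj_bimod_def M.zero_closed M.add_closed M.scale_closed
        M.add_ac M.add_zero M.diff_self M.scale_add_right M.scale_add_left M.scale_scale
        M.scale_one)
  have complete: "complete_wrt ?N F \<longleftrightarrow> complete_wrt M F" for F
    unfolding complete_wrt_def diff by (simp add: conj_bimod_def)
  \<comment> \<open>The axioms treat one variable of each inner product. After the exchange of sides
    the other variable is needed, and its laws follow by taking adjoints.\<close>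
  have lip_conj: "lip M m (vadd M n p) = vadd A (lip M m n) (lip M m p)"
    if "m \<in> carr M" "n \<in> carr M" "p \<in> carr M" for m n p
    using lip_add[of n p m] that by (metis A.star_add M.add_closed lip_closed lip_star)
  have rip_conj: "rip M (vadd M m n) p = vadd A (rip M m p) (rip M n p)"
    if "m \<in> carr M" "n \<in> carr M" "p \<in> carr M" for m n p
    using rip_add[of p m n] that by (metis A.star_add M.add_closed rip_closed rip_star)
  have lip_sc: "lip M m (vscale M (cnj k) n) = vscale A k (lip M m n)"
    if "m \<in> carr M" "n \<in> carr M" for m n k
    using lip_scale[of n m "cnj k"] that
    by (metis A.star_scale M.scale_closed complex_cnj_cnj lip_closed lip_star)
  have rip_sc: "rip M (vscale M (cnj k) m) n = vscale A k (rip M m n)"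
    if "m \<in> carr M" "n \<in> carr M" for m n k
    using rip_scale[of n m "cnj k"] that
    by (metis A.star_scale M.scale_closed complex_cnj_cnj rip_closed rip_star)
  have lip_l: "lip M m (lact M (vstar A a) n) = vmult A (lip M m n) a"
    if "a \<in> carr A" "m \<in> carr M" "n \<in> carr M" for a m n
    using lip_lact[of "vstar A a" n m] that
    by (metis A.star_closed A.star_mult A.star_star lact_closed lip_closed lip_star)
  have rip_r: "rip M (ract M m (vstar A a)) n = vmult A a (rip M m n)"
    if "a \<in> carr A" "m \<in> carr M" "n \<in> carr M" for a m n
    using rip_ract[of "vstar A a" n m] that
    by (metis A.star_closed A.star_mult A.star_star ract_closed rip_closed rip_star)
  show ?thesis
  proof (intro hilbert_bimodule.intro left_hilbert_module.intro right_hilbert_module.intro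
      left_hilbert_module_axioms.intro right_hilbert_module_axioms.intro hilbert_bimodule_axioms.intro
      A.cstar_algebra_axioms vs)
  qed (simp_all add: complete, simp_all add: conj_bimod_def A.star_closed A.star_add A.star_scale
      A.star_mult lact_closed ract_closed lact_add_right lact_add_left lact_scale_left
      lact_scale_right lact_mult ract_add_right ract_add_left ract_scale_left ract_scale_right
      ract_mult lip_closed rip_closed lip_star rip_star lip_positive rip_positive lip_definite
      rip_definite lip_complete rip_complete lip_conj rip_conj lip_sc rip_sc lip_l rip_r act_assoc
      ip_compat)
qed

text \<open>The adjoint is conjugate-linear and reverses products, as the conjugate scalars and the
  exchanged actions require; it also interchanges the two inner product relations.\<close>

lemma covariant_pair_conj:
  assumes M: "hilbert_bimodule A M" and B: "cstar_algebra B" and cov: "covariant_pair A M B jA jM"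
  shows "covariant_pair A (conj_bimod A M) B jA (\<lambda>m. vstar B (jM m))"
proof -
  interpret hilbert_bimodule A M by fact
  interpret B: cstar_algebra B by fact
  have cl: "\<And>a. a \<in> carr A \<Longrightarrow> jA a \<in> carr B" "\<And>m. m \<in> carr M \<Longrightarrow> jM m \<in> carr B"
    using cov by (auto simp: covariant_pair_def star_hom_def linear_on_carr_def)
  have star: "jA (vstar A a) = vstar B (jA a)" if "a \<in> carr A" for a
    using cov that by (simp add: covariant_pair_def star_hom_def)
  show ?thesis
    using cov unfolding covariant_pair_def
    by (auto simp: conj_bimod_def linear_on_carr_def cl star B.star_closed B.star_add B.star_scale
        B.star_mult B.star_star A.star_closed)
qed

lemma conj_conj_bimod:
  assumes "hilbert_bimodule A M" "a \<in> carr A"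
  shows "lact (conj_bimod A (conj_bimod A M)) a = lact M a"
    "ract (conj_bimod A (conj_bimod A M)) m a = ract M m a"
proof -
  interpret hilbert_bimodule A M by fact
  show "lact (conj_bimod A (conj_bimod A M)) a = lact M a"
    "ract (conj_bimod A (conj_bimod A M)) m a = ract M m a"
    using assms(2) by (simp_all add: conj_bimod_def A.star_star)
qed

text \<open>A double adjoint is known to be the identity only on \<open>carr A\<close>, so the
  double conjugate and \<open>M\<close> may differ as records; they still have the same covariant
  pairs.\<close>

lemma covariant_pair_conj_conj:
  assumes "hilbert_bimodule A M"
  shows "covariant_pair A (conj_bimod A (conj_bimod A M)) B jA jM = covariant_pair A M B jA jM"
proof -
  have "carr (conj_bimod A (conj_bimod A M)) = carr M"
    "lip (conj_bimod A (conj_bimod A M)) = lip M" "rip (conj_bimod A (conj_bimod A M)) = rip M"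
    "linear_on_carr (conj_bimod A (conj_bimod A M)) B jM = linear_on_carr M B jM"
    by (simp_all add: conj_bimod_def linear_on_carr_def)
  thus ?thesis by (simp add: covariant_pair_def conj_conj_bimod[OF assms])
qed

text \<open>The algebra stays the same and \<open>iM\<close> is replaced by its adjoint. A
  C*-subalgebra contains an element exactly when it contains its adjoint, and prescribing a
  homomorphism on one prescribes it on the other.\<close>

lemma is_crossed_product_conj:
  fixes M :: "('a, 'm) bimod"
  assumes "is_crossed_product A M D"
  shows "is_crossed_product A (conj_bimod A M) D"
proof -
  let ?N = "conj_bimod A M"
  have M: "hilbert_bimodule A M" and D: "cstar_algebra D"
    using assms by (simp_all add: is_crossed_product_def)
  interpret D: cstar_algebra D by fact
  have carr: "carr ?N = carr M" by (simp add: conj_bimod_def)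
  note N = hilbert_bimodule_conj[OF M]
  obtain iA iM where cov: "covariant_pair A M D iA iM"
    and gen: "generates (iA ` carr A \<union> iM ` carr M) D"
    and univ: "\<forall>(B :: ('a, 'm) cp_univ cstar) jA jM. cstar_algebra B \<and> covariant_pair A M B jA jM \<longrightarrow>
      factors_uniquely A M D iA iM B jA jM"
    using assms unfolding is_crossed_product_def by (elim conjE exE) (rule that)
  let ?iN = "\<lambda>m. vstar D (iM m)"
  have cl: "\<And>m. m \<in> carr M \<Longrightarrow> iM m \<in> carr D"
    using cov by (auto simp: covariant_pair_def linear_on_carr_def)
  have "generates (iA ` carr A \<union> ?iN ` carr ?N) D"
    unfolding generates_def
  proof (intro allI impI, elim conjE)
    fix S assume S: "iA ` carr A \<union> ?iN ` carr ?N \<subseteq> S" "S \<subseteq> carr D" "cstar_algebra (D\<lparr>carr := S\<rparr>)"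
    interpret S: cstar_algebra "D\<lparr>carr := S\<rparr>" by fact
    have "iM m \<in> S" if "m \<in> carr M" for m
    proof -
      have "vstar D (?iN m) \<in> S" using S(1) that S.star_closed[of "?iN m"] by (auto simp: carr)
      thus ?thesis using that by (simp add: D.star_star cl)
    qed
    hence "iA ` carr A \<union> iM ` carr M \<subseteq> S" using S(1) by blast
    thus "S = carr D" using gen S unfolding generates_def by blast
  qed
  moreover have "factors_uniquely A ?N D iA ?iN B jA jN"
    if B: "cstar_algebra B" and jN: "covariant_pair A ?N B jA jN" for B :: "('a, 'm) cp_univ cstar" and jA jN
  proof -
    interpret B: cstar_algebra B by fact
    \<comment> \<open>The adjoint of a pair for the conjugate is a pair for the double conjugate,
      hence for \<open>M\<close>, where the universal property of \<open>D\<close> applies.\<close>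
    have "covariant_pair A M B jA (\<lambda>m. vstar B (jN m))"
      using covariant_pair_conj[OF N B jN] by (simp add: covariant_pair_conj_conj[OF M])
    hence "factors_uniquely A M D iA iM B jA (\<lambda>m. vstar B (jN m))" using univ B by blast
    moreover have "factors_via A ?N D iA ?iN B jA jN f \<longleftrightarrow>
        factors_via A M D iA iM B jA (\<lambda>m. vstar B (jN m)) f" for f
    proof -
      have "f (?iN m) = jN m \<longleftrightarrow> f (iM m) = vstar B (jN m)" if "star_hom D B f" "m \<in> carr M" for m
      proof -
        have "jN m \<in> carr B" using jN that by (auto simp: covariant_pair_def linear_on_carr_def carr)
        moreover have "f (iM m) \<in> carr B" "f (?iN m) = vstar B (f (iM m))"
          using that cl by (auto simp: star_hom_def linear_on_carr_def)
        ultimately show ?thesis using B.star_star by metis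
      qed
      thus ?thesis by (auto simp: factors_via_def carr)
    qed
    ultimately show ?thesis by (simp add: factors_uniquely_def)
  qed
  ultimately show ?thesis
    unfolding is_crossed_product_def using N D covariant_pair_conj[OF M D cov] by blast
qed

section \<open>The circle\<close>

lemma zmul_abs_circle: "zmul k (abs_circle s) = abs_circle (of_int k * s)"
  by (simp add: zmul.abs_eq)

lemma zmul_arith:
  "zmul k (u + v) = zmul k u + zmul k v" "zmul k (u - v) = zmul k u - zmul k v"
  "zmul (k + l) u = zmul k u + zmul l u" "zmul k (zmul l u) = zmul (k * l) u"
  "zmul 0 u = 0" "zmul 1 u = u" "zmul k 0 = 0"
  by (transfer; simp add: algebra_simps)+

lemma abs_circle_add: "abs_circle (s + t) = abs_circle s + abs_circle t"
  by (simp add: plus_circle.abs_eq)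

lemma abs_circle_of_int: "abs_circle (of_int k) = 0"
  by (simp add: zero_circle_def abs_circle_eq_iff)

lemma e_circle_add: "e_circle (u + v) = e_circle u * e_circle v"
  by transfer (simp add: distrib_left exp_add)

lemma e_circle_0: "e_circle 0 = 1"
  by transfer simp

lemma e_circle_minus: "e_circle (- u) = cnj (e_circle u)"
  by transfer (simp add: exp_cnj)

lemma continuous_on_e_abs_circle: "continuous_on UNIV (\<lambda>s. e_circle (abs_circle s))"
  by (simp add: e_circle.abs_eq) (intro continuous_intros)

text \<open>Applying \<open>abs_circle\<close> to the second coordinate is an open surjection, so
  continuity can be checked on the lift. This serves formulas written with
  \<open>rep_circle\<close>.\<close>

lemma continuous_on_cylinderI:
  fixes f :: "real \<times> circle \<Rightarrow> 'b :: topological_space"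
  assumes "continuous_on UNIV (\<lambda>(x, s). f (x, abs_circle s))"
  shows "continuous_on UNIV f"
proof (subst continuous_on_open_vimage[OF open_UNIV], intro allI impI)
  fix B :: "'b set" assume "open B"
  let ?q = "\<lambda>(x, s). (x :: real, abs_circle s)"
  have op: "open ((\<lambda>(x, s). f (x, abs_circle s)) -` B)" (is "open ?W")
    using assms \<open>open B\<close> by (intro open_vimage) auto
  have eq: "f -` B \<inter> UNIV = ?q ` ?W"
  proof (intro set_eqI iffI)
    fix z assume "z \<in> f -` B \<inter> UNIV"
    thus "z \<in> ?q ` ?W" by (intro image_eqI[where x = "(fst z, rep_circle (snd z))"]) auto
  qed auto
  show "open (f -` B \<inter> UNIV)"
    unfolding eq
  proof (subst open_subopen, intro ballI)
    fix z assume "z \<in> ?q ` ?W"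
    then obtain x s where xs: "(x, s) \<in> ?W" "z = (x, abs_circle s)" by auto
    obtain U V where UV: "open U" "open V" "x \<in> U" "s \<in> V" "U \<times> V \<subseteq> ?W"
      using open_prod_elim[OF op xs(1)] by (metis mem_Sigma_iff)
    show "\<exists>T. open T \<and> z \<in> T \<and> T \<subseteq> ?q ` ?W"
    proof (intro exI conjI)
      show "open (U \<times> abs_circle ` V)" by (intro open_Times open_map_abs_circle UV)
      show "z \<in> U \<times> abs_circle ` V" using UV xs by auto
      show "U \<times> abs_circle ` V \<subseteq> ?q ` ?W"
      proof
        fix w assume "w \<in> U \<times> abs_circle ` V"
        then obtain u v where "u \<in> U" "v \<in> V" "w = ?q (u, v)" by auto
        thus "w \<in> ?q ` ?W" using UV(5) by blast
      qed
    qed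
  qed
qed

lemma continuous_on_torus_liftI:
  fixes f :: "torus \<Rightarrow> 'b :: topological_space"
  assumes "continuous_on UNIV (\<lambda>(x, s). f (abs_circle x, abs_circle s))"
  shows "continuous_on UNIV f"
  by (intro continuous_on_torusI continuous_on_cylinderI) (use assms in simp)

lemma continuous_on_abs_circle_compose:
  "continuous_on S f \<Longrightarrow> continuous_on S (\<lambda>x. abs_circle (f x))"
  by (rule continuous_on_compose2[OF continuous_on_abs_circle]) auto

section \<open>Isomorphisms between the bimodules of quantum Heisenberg manifolds\<close>

abbreviation QHM_bimod :: "nat \<Rightarrow> circle \<Rightarrow> circle \<Rightarrow> (torus \<Rightarrow> complex, real \<times> circle \<Rightarrow> complex) bimod"
  where "QHM_bimod c \<mu> \<nu> \<equiv> twist C_torus (X_bimod c \<nu>) (alpha \<mu> \<nu>)"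

definition torus_proj :: "real \<times> circle \<Rightarrow> torus"
  where "torus_proj = (\<lambda>(x, y). (abs_circle x, y))"

lemma torus_proj_surj: obtains p where "z = torus_proj p"
proof
  show "z = torus_proj (rep_circle (fst z), snd z)" by (simp add: torus_proj_def)
qed

lemma QHM_carr:
  "f \<in> carr (QHM_bimod c \<mu> \<nu>) \<longleftrightarrow> continuous_on UNIV f \<and>
    (\<forall>x y. f (x + 1, y) = e_circle (zmul (- int c) (y - \<nu>)) * f (x, y))"
  by (simp add: twist_def X_bimod_def)

lemma QHM_simps:
  "vzero (QHM_bimod c \<mu> \<nu>) = (\<lambda>_. 0)" "vadd (QHM_bimod c \<mu> \<nu>) f g = (\<lambda>p. f p + g p)"
  "vscale (QHM_bimod c \<mu> \<nu>) k f = (\<lambda>p. k * f p)"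
  "lact (QHM_bimod c \<mu> \<nu>) a f = (\<lambda>p. a (torus_proj p) * f p)"
  "ract (QHM_bimod c \<mu> \<nu>) f a = (\<lambda>p. f p * a (torus_proj p - (zmul 2 \<mu>, zmul 2 \<nu>)))"
  by (auto simp: twist_def X_bimod_def torus_proj_def alpha_def)

lemma e_circle_cnj_mult: "e_circle u * cnj (e_circle u) = 1"
  by (simp add: complex_norm_square[symmetric] e_circle_norm)

lemma quasi_periodic_product:
  assumes "f \<in> carr (QHM_bimod c \<mu> \<nu>)" "g \<in> carr (QHM_bimod c \<mu> \<nu>)"
  shows "f (x + 1, y) * cnj (g (x + 1, y)) = f (x, y) * cnj (g (x, y))"
proof -
  let ?e = "e_circle (zmul (- int c) (y - \<nu>))"
  have "f (x + 1, y) * cnj (g (x + 1, y)) = (?e * cnj ?e) * (f (x, y) * cnj (g (x, y)))"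
    using assms by (simp add: QHM_carr)
  thus ?thesis by (simp only: e_circle_cnj_mult) simp
qed

lemma QHM_lip:
  assumes "f \<in> carr (QHM_bimod c \<mu> \<nu>)" "g \<in> carr (QHM_bimod c \<mu> \<nu>)"
  shows "lip (QHM_bimod c \<mu> \<nu>) f g (torus_proj p) = f p * cnj (g p)"
proof -
  have "lip (QHM_bimod c \<mu> \<nu>) f g = descend (\<lambda>p. f p * cnj (g p))"
    by (simp add: twist_def X_bimod_def)
  thus ?thesis
    using quasi_periodic_product[OF assms] by (cases p) (simp add: torus_proj_def descend_abs)
qed

text \<open>The twist applies the inverse of \<open>alpha \<mu> \<nu>\<close>, which evaluates at a
  point moved forward by twice \<open>(\<mu>, \<nu>)\<close>; subtracting that vector from the
  argument leaves the pointwise product.\<close>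

lemma QHM_rip:
  assumes "f \<in> carr (QHM_bimod c \<mu> \<nu>)" "g \<in> carr (QHM_bimod c \<mu> \<nu>)"
  shows "rip (QHM_bimod c \<mu> \<nu>) f g (torus_proj p - (zmul 2 \<mu>, zmul 2 \<nu>)) = cnj (f p) * g p"
proof -
  let ?h = "\<lambda>p. cnj (f p) * g p"
  have per: "?h (x + 1, y) = ?h (x, y)" for x y
    using quasi_periodic_product[OF assms(2,1), of x y] by (simp add: mult.commute)
  have "continuous_on UNIV ?h" using assms by (intro continuous_intros) (simp_all add: QHM_carr)
  hence "descend ?h \<in> carr C_torus" using per by (simp add: C_torus_def descend_continuous)
  moreover have "rip (QHM_bimod c \<mu> \<nu>) f g = inv_into (carr C_torus) (alpha \<mu> \<nu>) (descend ?h)"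
    by (simp add: twist_def X_bimod_def)
  ultimately have "rip (QHM_bimod c \<mu> \<nu>) f g = alpha (- \<mu>) (- \<nu>) (descend ?h)"
    by (simp add: inv_into_alpha)
  thus ?thesis using per by (cases p) (simp add: torus_proj_def alpha_def zmul_minus descend_abs)
qed

lemma quasi_periodic_int:
  assumes "f \<in> carr (QHM_bimod c \<mu> \<nu>)"
  shows "f (x + of_int n, y) = e_circle (zmul (- int c * n) (y - \<nu>)) * f (x, y)"
proof -
  let ?v = "zmul (- int c) (y - \<nu>)"
  have step: "f (x + 1, y) = e_circle ?v * f (x, y)" for x using assms by (simp add: QHM_carr)
  \<comment> \<open>This is \<open>f\<close> divided by an exponential with the same multiplier,
    hence 1-periodic; \<open>periodic_int\<close> then covers negative \<open>n\<close> as
    well.\<close>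
  let ?h = "\<lambda>x. f (x, y) * cnj (e_circle (abs_circle (x * rep_circle ?v)))"
  have "?h (x + 1) = ?h x" for x
  proof -
    have "?h (x + 1) = f (x, y) * cnj (e_circle (abs_circle (x * rep_circle ?v))) * (e_circle ?v * cnj (e_circle ?v))"
      by (simp only: step distrib_right abs_circle_add e_circle_add complex_cnj_mult mult_1 abs_rep_circle mult_ac)
    thus ?thesis by (simp only: e_circle_cnj_mult mult_1_right)
  qed
  hence "?h (x + of_int n) = ?h x" by (rule periodic_int) simp
  hence "f (x + of_int n, y) * cnj (e_circle (abs_circle (x * rep_circle ?v)))
      * cnj (e_circle (zmul n ?v)) = ?h x"
    by (subst (2) abs_rep_circle[symmetric])
      (simp add: distrib_right abs_circle_add e_circle_add zmul_abs_circle mult_ac del: abs_rep_circle)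
  moreover have "cnj (e_circle w) * e_circle w = 1" for w using e_circle_cnj_mult[of w] by (simp add: mult.commute)
  ultimately have "f (x + of_int n, y) = e_circle (zmul n ?v) * f (x, y)"
    by (smt (verit) mult.assoc mult.commute mult_1)
  thus ?thesis by (simp add: zmul_arith mult.commute)
qed

section \<open>Morphisms induced by maps of the torus\<close>

lemma torus_pullback_closed:
  assumes "continuous_on UNIV (h :: torus \<Rightarrow> torus)" "a \<in> carr C_torus"
  shows "a \<circ> h \<in> carr C_torus"
  using assms continuous_on_compose2[of UNIV a UNIV h] by (simp add: C_torus_def o_def)

lemma star_hom_torus_pullback:
  fixes h :: "torus \<Rightarrow> torus"
  assumes "continuous_on UNIV h" shows "star_hom C_torus C_torus (\<lambda>a. a \<circ> h)"
  unfolding star_hom_def linear_on_carr_def C_torus_def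
  by (auto intro: continuous_on_compose2[OF _ assms] simp: o_def)

text \<open>A unimodular factor cancels in both inner products, \<open>k\<close> covers
  \<open>h\<close> so that the left structures match, and the intertwining of the translations by
  \<open>h\<close> takes care of the twisted right structure. Quasi-periodicity enters through
  \<open>closed\<close>.\<close>

lemma QHM_bimod_morphismI:
  assumes h: "continuous_on UNIV h" "\<And>p. h (p - (zmul 2 \<mu>', zmul 2 \<nu>')) = h p - (zmul 2 \<mu>, zmul 2 \<nu>)"
    and k: "\<And>p. torus_proj (k p) = h (torus_proj p)" and u: "\<And>p. cmod (u p) = 1"
    and closed: "\<And>f. f \<in> carr (QHM_bimod c \<mu> \<nu>) \<Longrightarrow> (\<lambda>p. u p * f (k p)) \<in> carr (QHM_bimod c \<mu>' \<nu>')"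
  shows "bimod_morphism C_torus (QHM_bimod c \<mu> \<nu>) C_torus (QHM_bimod c \<mu>' \<nu>')
    (\<lambda>a. a \<circ> h) (\<lambda>f p. u p * f (k p))"
proof -
  let ?M = "QHM_bimod c \<mu> \<nu>" and ?N = "QHM_bimod c \<mu>' \<nu>'"
  let ?\<phi> = "\<lambda>f p. u p * f (k p)"
  have uu: "u p * cnj (u p) = 1" for p using u[of p] by (simp add: complex_norm_square[symmetric])
  have "lip ?N (?\<phi> f) (?\<phi> g) = lip ?M f g \<circ> h" if "f \<in> carr ?M" "g \<in> carr ?M" for f g
  proof
    fix z
    obtain p where z: "z = torus_proj p" by (rule torus_proj_surj)
    have "lip ?N (?\<phi> f) (?\<phi> g) z = (u p * cnj (u p)) * (f (k p) * cnj (g (k p)))"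
      using that by (simp add: z QHM_lip closed)
    thus "lip ?N (?\<phi> f) (?\<phi> g) z = (lip ?M f g \<circ> h) z"
      using that by (simp add: z uu QHM_lip flip: k)
  qed
  moreover have "rip ?N (?\<phi> f) (?\<phi> g) = rip ?M f g \<circ> h" if "f \<in> carr ?M" "g \<in> carr ?M" for f g
  proof
    fix z
    obtain p where "z + (zmul 2 \<mu>', zmul 2 \<nu>') = torus_proj p" by (rule torus_proj_surj)
    hence z: "z = torus_proj p - (zmul 2 \<mu>', zmul 2 \<nu>')" by (simp add: eq_diff_eq)
    have "rip ?N (?\<phi> f) (?\<phi> g) z = (u p * cnj (u p)) * (cnj (f (k p)) * g (k p))"
      using that by (simp only: z QHM_rip closed) simp
    thus "rip ?N (?\<phi> f) (?\<phi> g) z = (rip ?M f g \<circ> h) z"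
      using that by (simp add: z uu h(2) QHM_rip flip: k)
  qed
  ultimately show ?thesis
    unfolding bimod_morphism_def linear_on_carr_def
    by (auto simp: star_hom_torus_pullback h k closed QHM_simps algebra_simps)
qed

lemma bimod_isomorphicI:
  assumes "bimod_morphism A M B N \<sigma> \<phi>"
    and "\<And>b. b \<in> carr B \<Longrightarrow> \<tau> b \<in> carr A" "\<And>n. n \<in> carr N \<Longrightarrow> \<psi> n \<in> carr M"
    and "\<And>a. \<tau> (\<sigma> a) = a" "\<And>b. \<sigma> (\<tau> b) = b" "\<And>m. \<psi> (\<phi> m) = m" "\<And>n. \<phi> (\<psi> n) = n"
  shows "bimod_isomorphic A M B N"
proof -
  have "bij_betw \<sigma> (carr A) (carr B)" "bij_betw \<phi> (carr M) (carr N)"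
    using assms bimod_morphism_closed[OF assms(1)]
    by (intro bij_betwI[where g = \<tau>] bij_betwI[where g = \<psi>]; auto)+
  thus ?thesis using assms(1) unfolding bimod_isomorphic_def by blast
qed

text \<open>The phase \<open>e (c k (s (s - 1) / 2 - s t))\<close> corrects the multiplier by which a shear changes
  the quasi-periodicity condition; here \<open>t\<close> is a real representative of \<open>u\<close>.\<close>

definition shear_phase :: "nat \<Rightarrow> int \<Rightarrow> circle \<Rightarrow> real \<Rightarrow> complex"
  where "shear_phase c k u s =
    e_circle (abs_circle (of_nat c * of_int k * (s * (s - 1) / 2 - s * rep_circle u)))"

text \<open>When \<open>s\<close> grows by 1, \<open>s (s - 1) / 2\<close> grows by
  \<open>s\<close>, so the exponent grows by \<open>c k (s - t)\<close> with \<open>t\<close> the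
  representative of \<open>u\<close>: a quadratic phase has an affine multiplier.\<close>

lemma shear_phase_step:
  "shear_phase c k u (s + 1) = e_circle (zmul (int c * k) (abs_circle s - u)) * shear_phase c k u s"
proof -
  have "abs_circle s - u = abs_circle (s - rep_circle u)"
    by (simp flip: minus_circle.abs_eq)
  thus ?thesis
    by (simp add: shear_phase_def zmul_abs_circle flip: e_circle_add abs_circle_add)
      (simp add: field_simps)
qed

lemma shear_phase_norm: "cmod (shear_phase c k u s) = 1"
  by (simp add: shear_phase_def e_circle_norm)

lemma shear_phase_minus: "shear_phase c (- k) u s * shear_phase c k u s = 1"
  by (simp add: shear_phase_def e_circle_0 abs_circle_of_int[of 0, simplified] flip: e_circle_add abs_circle_add)

lemma continuous_on_shear_phase: "continuous_on UNIV (shear_phase c k u)"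
  unfolding shear_phase_def
  by (rule continuous_on_compose2[OF continuous_on_e_abs_circle]) (auto intro!: continuous_intros)

section \<open>The shears of the torus and of the sections\<close>

definition torus_shear_x :: "int \<Rightarrow> torus \<Rightarrow> torus"
  where "torus_shear_x k = (\<lambda>(x, y). (x + zmul k y, y))"

definition torus_shear_y :: "int \<Rightarrow> torus \<Rightarrow> torus"
  where "torus_shear_y k = (\<lambda>(x, y). (x, y + zmul k x))"

lemma continuous_on_torus_shear:
  "continuous_on UNIV (torus_shear_x k)" "continuous_on UNIV (torus_shear_y k)"
proof -
  have "continuous_on UNIV (\<lambda>z :: real \<times> real. (abs_circle (fst z + of_int k * snd z), abs_circle (snd z)))"
    by (intro continuous_on_Pair continuous_on_abs_circle_compose continuous_intros)
  thus "continuous_on UNIV (torus_shear_x k)"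
    by (intro continuous_on_torus_liftI)
      (simp add: torus_shear_x_def zmul_abs_circle abs_circle_add case_prod_unfold)
  have "continuous_on UNIV (\<lambda>z :: real \<times> real. (abs_circle (fst z), abs_circle (snd z + of_int k * fst z)))"
    by (intro continuous_on_Pair continuous_on_abs_circle_compose continuous_intros)
  thus "continuous_on UNIV (torus_shear_y k)"
    by (intro continuous_on_torus_liftI)
      (simp add: torus_shear_y_def zmul_abs_circle abs_circle_add case_prod_unfold)
qed

lemma torus_shear_minus:
  "torus_shear_x (- k) (torus_shear_x k p) = p" "torus_shear_y (- k) (torus_shear_y k p) = p"
  "torus_shear_x k (torus_shear_x (- k) p) = p" "torus_shear_y k (torus_shear_y (- k) p) = p"
proof -
  have "zmul (- k) u = - zmul k u" for u by transfer simp
  thus "torus_shear_x (- k) (torus_shear_x k p) = p" "torus_shear_y (- k) (torus_shear_y k p) = p"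
    "torus_shear_x k (torus_shear_x (- k) p) = p" "torus_shear_y k (torus_shear_y (- k) p) = p"
    by (cases p, simp add: torus_shear_x_def torus_shear_y_def)+
qed

definition shear_y :: "nat \<Rightarrow> circle \<Rightarrow> int \<Rightarrow> (real \<times> circle \<Rightarrow> complex) \<Rightarrow> real \<times> circle \<Rightarrow> complex"
  where "shear_y c \<mu> k f p =
    shear_phase c k \<mu> (fst p) * f (fst p, snd p + abs_circle (of_int k * fst p))"

definition shear_x :: "nat \<Rightarrow> circle \<Rightarrow> int \<Rightarrow> (real \<times> circle \<Rightarrow> complex) \<Rightarrow> real \<times> circle \<Rightarrow> complex"
  where "shear_x c \<nu> k f p =
    shear_phase c k \<nu> (rep_circle (snd p)) * f (fst p + of_int k * rep_circle (snd p), snd p)"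

lemma continuous_on_abs_circle_snd:
  assumes "continuous_on UNIV (f :: real \<times> circle \<Rightarrow> complex)"
    "continuous_on UNIV g" "continuous_on UNIV h"
  shows "continuous_on UNIV (\<lambda>z. f (g z, abs_circle (h z)))"
  by (rule continuous_on_compose2[OF assms(1)])
    (auto intro!: continuous_on_Pair continuous_on_abs_circle_compose assms)

text \<open>Substituting \<open>y + k x\<close> for \<open>y\<close> turns the exponent of the
  multiplier into \<open>- c (y + k x - \<nu>)\<close>. The phase adds
  \<open>c k (x - \<mu>)\<close>, which removes \<open>k x\<close> and leaves the multiplier for
  \<open>\<nu> - k \<mu>\<close>.\<close>

lemma shear_y_closed:
  assumes f: "f \<in> carr (QHM_bimod c \<mu> \<nu>)"
  shows "shear_y c \<mu> k f \<in> carr (QHM_bimod c \<mu> (\<nu> - zmul k \<mu>))"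
  unfolding QHM_carr
proof (intro conjI allI)
  have cf: "continuous_on UNIV f" using f by (simp add: QHM_carr)
  have "continuous_on UNIV (\<lambda>z :: real \<times> real.
      shear_phase c k \<mu> (fst z) * f (fst z, abs_circle (snd z + of_int k * fst z)))"
    by (intro continuous_intros continuous_on_compose2[OF continuous_on_shear_phase]
        continuous_on_abs_circle_snd cf) auto
  thus "continuous_on UNIV (shear_y c \<mu> k f)"
    by (intro continuous_on_cylinderI) (simp add: shear_y_def abs_circle_add case_prod_unfold)
  fix x y
  have k: "abs_circle (of_int k * (x + 1)) = abs_circle (of_int k * x)"
    by (simp add: distrib_left abs_circle_add abs_circle_of_int)
  let ?y = "y + abs_circle (of_int k * x)"
  have "zmul (int c * k) (abs_circle x - \<mu>) + zmul (- int c) (?y - \<nu>)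
      = zmul (- int c) (y - (\<nu> - zmul k \<mu>))"
    unfolding zmul_abs_circle[symmetric]
    by (transfer fixing: c k x) (simp add: algebra_simps)
  moreover have "f (x + 1, ?y) = e_circle (zmul (- int c) (?y - \<nu>)) * f (x, ?y)"
    using f unfolding QHM_carr by blast
  ultimately show "shear_y c \<mu> k f (x + 1, y) =
      e_circle (zmul (- int c) (y - (\<nu> - zmul k \<mu>))) * shear_y c \<mu> k f (x, y)"
    by (simp add: shear_y_def k shear_phase_step mult_ac flip: e_circle_add)
qed

text \<open>Here the phase has a different task. Replacing the representative \<open>s\<close> of
  \<open>y\<close> by \<open>s + 1\<close> shifts the first variable by \<open>k\<close>, which adds
  \<open>- c k (y - \<nu>)\<close> to the exponent; the phase adds the opposite, so the value
  depends on \<open>y\<close> alone. The quasi-periodicity involves only \<nu>, so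
  \<open>\<mu>'\<close> is free.\<close>

lemma shear_x_closed:
  assumes f: "f \<in> carr (QHM_bimod c \<mu> \<nu>)"
  shows "shear_x c \<nu> k f \<in> carr (QHM_bimod c \<mu>' \<nu>)"
  unfolding QHM_carr
proof (intro conjI allI)
  have cf: "continuous_on UNIV f" using f by (simp add: QHM_carr)
  \<comment> \<open>\<open>?G\<close> lets any real \<open>s\<close> stand for
    \<open>rep_circle y\<close>. Its periodicity in \<open>s\<close> gives \<open>shear_x\<close> a
    continuous lift, although \<open>rep_circle\<close> itself cannot be continuous.\<close>
  let ?G = "\<lambda>x s. shear_phase c k \<nu> s * f (x + of_int k * s, abs_circle s)"
  have "?G x (s + 1) = ?G x s" for x s
  proof -
    have one: "abs_circle (s + 1) = abs_circle s" by (simp add: abs_circle_eq_iff)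
    have arg: "x + of_int k * (s + 1) = (x + of_int k * s) + of_int k" by (simp add: algebra_simps)
    have "zmul (int c * k) v + zmul (- int c * k) v = 0" for v
      by (simp flip: zmul_arith(3)) (simp add: zmul_arith)
    thus ?thesis
      unfolding arg one quasi_periodic_int[OF f] shear_phase_step
      by (simp add: e_circle_0 mult_ac flip: e_circle_add)
  qed
  hence "?G x (rep_circle (abs_circle s)) = ?G x s" for x s
    by (rule periodic_int) (simp flip: abs_circle_eq_iff)
  hence eq: "shear_x c \<nu> k f (x, abs_circle s) = ?G x s" for x s by (simp add: shear_x_def)
  have "continuous_on UNIV (\<lambda>z :: real \<times> real. ?G (fst z) (snd z))"
    by (intro continuous_intros continuous_on_compose2[OF continuous_on_shear_phase]
        continuous_on_abs_circle_snd cf) auto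
  thus "continuous_on UNIV (shear_x c \<nu> k f)"
    by (intro continuous_on_cylinderI) (simp add: eq case_prod_unfold)
  fix x y
  let ?x = "x + of_int k * rep_circle y"
  have "f (?x + 1, y) = e_circle (zmul (- int c) (y - \<nu>)) * f (?x, y)"
    using f unfolding QHM_carr by blast
  thus "shear_x c \<nu> k f (x + 1, y) = e_circle (zmul (- int c) (y - \<nu>)) * shear_x c \<nu> k f (x, y)"
    by (simp add: shear_x_def algebra_simps)
qed

text \<open>The torus map sends the new translation vector to the old one, because pullback reverses
  direction; this accounts for the minus sign in the new parameter.\<close>

lemma QHM_shear_y:
  "bimod_isomorphic C_torus (QHM_bimod c \<mu> \<nu>) C_torus (QHM_bimod c \<mu> (\<nu> - zmul k \<mu>))"
proof (rule bimod_isomorphicI)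
  have "bimod_morphism C_torus (QHM_bimod c \<mu> \<nu>) C_torus (QHM_bimod c \<mu> (\<nu> - zmul k \<mu>))
    (\<lambda>a. a \<circ> torus_shear_y k)
    (\<lambda>f p. shear_phase c k \<mu> (fst p) * f (fst p, snd p + abs_circle (of_int k * fst p)))"
  proof (rule QHM_bimod_morphismI)
    show "torus_shear_y k (p - (zmul 2 \<mu>, zmul 2 (\<nu> - zmul k \<mu>))) =
        torus_shear_y k p - (zmul 2 \<mu>, zmul 2 \<nu>)" for p
      by (cases p) (simp add: torus_shear_y_def zmul_arith mult.commute)
    show "torus_proj (fst p, snd p + abs_circle (of_int k * fst p)) = torus_shear_y k (torus_proj p)" for p
      by (cases p) (simp add: torus_shear_y_def torus_proj_def zmul_abs_circle)
  qed (simp_all add: continuous_on_torus_shear shear_phase_norm shear_y_closed flip: shear_y_def)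
  thus "bimod_morphism C_torus (QHM_bimod c \<mu> \<nu>) C_torus (QHM_bimod c \<mu> (\<nu> - zmul k \<mu>))
    (\<lambda>a. a \<circ> torus_shear_y k) (shear_y c \<mu> k)"
    by (simp flip: shear_y_def)
  show "b \<circ> torus_shear_y (- k) \<in> carr C_torus" if "b \<in> carr C_torus" for b
    using torus_pullback_closed[OF continuous_on_torus_shear(2) that] .
  show "shear_y c \<mu> (- k) g \<in> carr (QHM_bimod c \<mu> \<nu>)"
    if "g \<in> carr (QHM_bimod c \<mu> (\<nu> - zmul k \<mu>))" for g
  proof -
    have "\<nu> - zmul k \<mu> - zmul (- k) \<mu> = \<nu>" by transfer simp
    thus ?thesis using shear_y_closed[OF that, of "- k"] by (simp only:)
  qed
  have inv: "shear_y c \<mu> (- l) (shear_y c \<mu> l f) = f" for f l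
  proof
    fix p :: "real \<times> circle"
    have "abs_circle (- (of_int l * fst p)) + abs_circle (of_int l * fst p) = 0"
      by (simp flip: abs_circle_add) (simp add: zero_circle_def)
    thus "shear_y c \<mu> (- l) (shear_y c \<mu> l f) p = f p"
      using shear_phase_minus[of c l \<mu> "fst p"] by (simp add: shear_y_def add.assoc flip: mult.assoc)
  qed
  show "shear_y c \<mu> (- k) (shear_y c \<mu> k f) = f" for f by (rule inv)
  show "shear_y c \<mu> k (shear_y c \<mu> (- k) f) = f" for f using inv[of "- k" f] by simp
qed (simp_all add: fun_eq_iff torus_shear_minus)

lemma QHM_shear_x:
  "bimod_isomorphic C_torus (QHM_bimod c \<mu> \<nu>) C_torus (QHM_bimod c (\<mu> - zmul k \<nu>) \<nu>)"
proof (rule bimod_isomorphicI)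
  have "bimod_morphism C_torus (QHM_bimod c \<mu> \<nu>) C_torus (QHM_bimod c (\<mu> - zmul k \<nu>) \<nu>)
    (\<lambda>a. a \<circ> torus_shear_x k)
    (\<lambda>f p. shear_phase c k \<nu> (rep_circle (snd p)) * f (fst p + of_int k * rep_circle (snd p), snd p))"
  proof (rule QHM_bimod_morphismI)
    show "torus_shear_x k (p - (zmul 2 (\<mu> - zmul k \<nu>), zmul 2 \<nu>)) =
        torus_shear_x k p - (zmul 2 \<mu>, zmul 2 \<nu>)" for p
      by (cases p) (simp add: torus_shear_x_def zmul_arith mult.commute)
    show "torus_proj (fst p + of_int k * rep_circle (snd p), snd p) = torus_shear_x k (torus_proj p)" for p
      by (cases p) (simp add: torus_shear_x_def torus_proj_def abs_circle_add flip: zmul_abs_circle)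
  qed (simp_all add: continuous_on_torus_shear shear_phase_norm shear_x_closed flip: shear_x_def)
  thus "bimod_morphism C_torus (QHM_bimod c \<mu> \<nu>) C_torus (QHM_bimod c (\<mu> - zmul k \<nu>) \<nu>)
    (\<lambda>a. a \<circ> torus_shear_x k) (shear_x c \<nu> k)"
    by (simp flip: shear_x_def)
  show "b \<circ> torus_shear_x (- k) \<in> carr C_torus" if "b \<in> carr C_torus" for b
    using torus_pullback_closed[OF continuous_on_torus_shear(1) that] .
  have inv: "shear_x c \<nu> (- l) (shear_x c \<nu> l f) = f" for f l
  proof
    fix p :: "real \<times> circle"
    show "shear_x c \<nu> (- l) (shear_x c \<nu> l f) p = f p"
      using shear_phase_minus[of c l \<nu> "rep_circle (snd p)"]
      by (simp add: shear_x_def flip: mult.assoc)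
  qed
  show "shear_x c \<nu> (- k) (shear_x c \<nu> k f) = f" for f by (rule inv)
  show "shear_x c \<nu> k (shear_x c \<nu> (- k) f) = f" for f using inv[of "- k" f] by simp
qed (simp_all add: fun_eq_iff torus_shear_minus shear_x_closed)

section \<open>Reflection and the conjugate bimodule\<close>

definition QHM_reflect :: "circle \<Rightarrow> (real \<times> circle \<Rightarrow> complex) \<Rightarrow> real \<times> circle \<Rightarrow> complex"
  where "QHM_reflect \<nu> f = (\<lambda>(x, y). cnj (f (x, zmul 2 \<nu> - y)))"

text \<open>The reflection fixes \<nu> and changes the sign of \<open>y - \<nu>\<close>, hence of
  the degree; complex conjugation changes it back.\<close>

lemma QHM_reflect_closed:
  assumes f: "f \<in> carr (QHM_bimod c \<mu> \<nu>)"
  shows "QHM_reflect \<nu> f \<in> carr (QHM_bimod c \<mu>' \<nu>)"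
  unfolding QHM_carr
proof (intro conjI allI)
  have cf: "continuous_on UNIV f" using f by (simp add: QHM_carr)
  have "abs_circle (2 * rep_circle \<nu> - s) = zmul 2 \<nu> - abs_circle s" for s
    using zmul_abs_circle[of 2 "rep_circle \<nu>"] by (simp flip: minus_circle.abs_eq)
  moreover have "continuous_on UNIV (\<lambda>z :: real \<times> real. cnj (f (fst z, abs_circle (2 * rep_circle \<nu> - snd z))))"
    by (intro continuous_intros continuous_on_abs_circle_snd cf)
  ultimately show "continuous_on UNIV (QHM_reflect \<nu> f)"
    by (intro continuous_on_cylinderI) (simp add: QHM_reflect_def case_prod_unfold)
  fix x y
  have "- zmul (- int c) (zmul 2 \<nu> - y - \<nu>) = zmul (- int c) (y - \<nu>)"
    by transfer (simp add: algebra_simps)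
  hence "cnj (e_circle (zmul (- int c) (zmul 2 \<nu> - y - \<nu>))) = e_circle (zmul (- int c) (y - \<nu>))"
    by (simp flip: e_circle_minus)
  moreover have "f (x + 1, zmul 2 \<nu> - y) =
      e_circle (zmul (- int c) (zmul 2 \<nu> - y - \<nu>)) * f (x, zmul 2 \<nu> - y)"
    using f unfolding QHM_carr by blast
  ultimately show "QHM_reflect \<nu> f (x + 1, y) = e_circle (zmul (- int c) (y - \<nu>)) * QHM_reflect \<nu> f (x, y)"
    by (simp add: QHM_reflect_def)
qed

text \<open>Conjugation inverts the translation vector, and the reflection in \<open>y\<close>
  restores the sign of its second entry, so only \<mu> changes sign.\<close>

lemma QHM_conj:
  "bimod_isomorphic C_torus (QHM_bimod c \<mu> \<nu>) C_torus (conj_bimod C_torus (QHM_bimod c (- \<mu>) \<nu>))"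
proof (rule bimod_isomorphicI)
  let ?M = "QHM_bimod c \<mu> \<nu>" and ?N = "QHM_bimod c (- \<mu>) \<nu>"
  \<comment> \<open>With \<open>v = \<mu>\<close> this covers \<open>?r\<close> up to the
    translation by twice \<open>(\<mu>, \<nu>)\<close>. The offset appears because the left
    structure, evaluated at the point itself, and the right one, evaluated at a translated point,
    trade places.\<close>
  let ?h = "\<lambda>v (x, y). (x - zmul 2 v, - y) :: torus" and ?\<phi> = "QHM_reflect \<nu>"
  let ?r = "\<lambda>(x, y). (x :: real, zmul 2 \<nu> - y)"
  have h: "continuous_on UNIV (?h v)" for v
  proof -
    have v: "zmul 2 v = abs_circle (2 * rep_circle v)"
      using zmul_abs_circle[of 2 "rep_circle v"] by simp
    have "continuous_on UNIV (\<lambda>z :: real \<times> real. (abs_circle (fst z - 2 * rep_circle v), abs_circle (- snd z)))"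
      by (intro continuous_on_Pair continuous_on_abs_circle_compose continuous_intros)
    thus ?thesis
      by (intro continuous_on_torus_liftI)
        (simp add: v minus_circle.abs_eq uminus_circle.abs_eq case_prod_unfold)
  qed
  have \<phi>: "?\<phi> f p = cnj (f (?r p))" for f p by (simp add: QHM_reflect_def case_prod_unfold)
  \<comment> \<open>Evaluation at a translated point for \<open>?N\<close> becomes evaluation at the
    point itself for \<open>?M\<close>, and conversely.\<close>
  have r: "?h \<mu> (torus_proj p - (zmul 2 (- \<mu>), zmul 2 \<nu>)) = torus_proj (?r p)"
    "?h \<mu> (torus_proj p) = torus_proj (?r p) - (zmul 2 \<mu>, zmul 2 \<nu>)" for p
    by (simp_all add: torus_proj_def zmul_minus case_prod_unfold)
  have lip: "rip ?N (?\<phi> f) (?\<phi> g) = lip ?M f g \<circ> ?h \<mu>" if "f \<in> carr ?M" "g \<in> carr ?M" for f g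
  proof
    fix z
    obtain p where "z + (zmul 2 (- \<mu>), zmul 2 \<nu>) = torus_proj p" by (rule torus_proj_surj)
    hence z: "z = torus_proj p - (zmul 2 (- \<mu>), zmul 2 \<nu>)" by (simp add: eq_diff_eq)
    have "rip ?N (?\<phi> f) (?\<phi> g) z = f (?r p) * cnj (g (?r p))"
      using that by (simp only: z QHM_rip QHM_reflect_closed \<phi>) simp
    thus "rip ?N (?\<phi> f) (?\<phi> g) z = (lip ?M f g \<circ> ?h \<mu>) z"
      using that by (simp only: comp_apply z r QHM_lip)
  qed
  have rip: "lip ?N (?\<phi> f) (?\<phi> g) = rip ?M f g \<circ> ?h \<mu>" if "f \<in> carr ?M" "g \<in> carr ?M" for f g
  proof
    fix z
    obtain p where z: "z = torus_proj p" by (rule torus_proj_surj)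
    have "lip ?N (?\<phi> f) (?\<phi> g) z = cnj (f (?r p)) * g (?r p)"
      using that by (simp only: z QHM_lip QHM_reflect_closed \<phi>) simp
    thus "lip ?N (?\<phi> f) (?\<phi> g) z = (rip ?M f g \<circ> ?h \<mu>) z"
      using that by (simp only: comp_apply z r QHM_rip)
  qed
  have conj: "carr (conj_bimod C_torus ?N) = carr ?N" "vadd (conj_bimod C_torus ?N) = vadd ?N"
    "vscale (conj_bimod C_torus ?N) = (\<lambda>k. vscale ?N (cnj k))"
    "lact (conj_bimod C_torus ?N) = (\<lambda>a m. ract ?N m (\<lambda>p. cnj (a p)))"
    "ract (conj_bimod C_torus ?N) = (\<lambda>m a. lact ?N (\<lambda>p. cnj (a p)) m)"
    "lip (conj_bimod C_torus ?N) = rip ?N" "rip (conj_bimod C_torus ?N) = lip ?N"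
    by (simp_all add: conj_bimod_def C_torus_def)
  show "bimod_morphism C_torus ?M C_torus (conj_bimod C_torus ?N) (\<lambda>a. a \<circ> ?h \<mu>) ?\<phi>"
    unfolding bimod_morphism_def linear_on_carr_def conj
  proof (intro conjI ballI allI)
    show "?\<phi> (lact ?M a f) = ract ?N (?\<phi> f) (\<lambda>p. cnj ((a \<circ> ?h \<mu>) p))" for a f
      by (rule ext) (simp only: QHM_simps \<phi> comp_apply r, simp)
    show "?\<phi> (ract ?M f a) = lact ?N (\<lambda>p. cnj ((a \<circ> ?h \<mu>) p)) (?\<phi> f)" for a f
      by (rule ext) (simp only: QHM_simps \<phi> comp_apply r, simp)
  qed (auto simp: star_hom_torus_pullback h QHM_reflect_closed lip rip, auto simp: QHM_simps \<phi> fun_eq_iff)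
  show "b \<circ> ?h (- \<mu>) \<in> carr C_torus" if "b \<in> carr C_torus" for b
    using torus_pullback_closed[OF h that] .
  show "?\<phi> g \<in> carr ?M" if "g \<in> carr (conj_bimod C_torus ?N)" for g
    using QHM_reflect_closed that unfolding conj .
qed (simp_all add: fun_eq_iff zmul_minus QHM_reflect_def)

section \<open>Orbits of \<open>GL(2, \<int>)\<close>\<close>

text \<open>This is the Euclidean algorithm on the first column \<open>(a, c)\<close>, with
  \<open>\<bar>c\<bar>\<close> as measure. Row exchanges and signs are themselves composed from
  shears, so transitivity is the only closure property asked of \<open>R\<close>.\<close>

lemma SL2Z_shear_induct:
  fixes R :: "torus \<Rightarrow> torus \<Rightarrow> bool"
  assumes trans: "\<And>p q r. R p q \<Longrightarrow> R q r \<Longrightarrow> R p r"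
    and shear_x: "\<And>x y k. R (x, y) (x - zmul k y, y)"
    and shear_y: "\<And>x y k. R (x, y) (x, y - zmul k x)"
    and det: "a * d - b * c = 1"
  shows "R (x, y) (zmul a x + zmul b y, zmul c x + zmul d y)"
  using det
proof (induction "nat \<bar>c\<bar>" arbitrary: a b c d rule: less_induct)
  case less
  have minus: "zmul (- k) u = - zmul k u" for k u by transfer simp
  \<comment> \<open>The quarter turn is a product of three shears; its square is minus the
    identity.\<close>
  have rot: "R (u, v) (- v, u)" for u v
  proof -
    have "R (u, v) (u - v, v)" using shear_x[of u v 1] by (simp add: zmul_arith)
    moreover have "R (u - v, v) (u - v, u)"
      using shear_y[of "u - v" v "-1"] by (simp add: minus zmul_arith)
    moreover have "R (u - v, u) (- v, u)" using shear_x[of "u - v" u 1] by (simp add: zmul_arith)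
    ultimately show ?thesis using trans by blast
  qed
  show ?case
  proof (cases "c = 0")
    \<comment> \<open>An upper triangular matrix of determinant 1 is a shear, up to a sign that two
      quarter turns supply.\<close>
    case True
    hence "a * d = 1" using less.prems by simp
    hence "a = 1 \<and> d = 1 \<or> a = -1 \<and> d = -1" by (simp add: zmult_eq_1_iff)
    thus ?thesis
    proof
      assume "a = 1 \<and> d = 1"
      thus ?thesis using True shear_x[of x y "- b"] by (simp add: zmul_arith minus)
    next
      assume "a = -1 \<and> d = -1"
      moreover have "R (x, y) (- x, - y)" using trans[OF rot rot] .
      moreover have "R (- x, - y) (- x + zmul b y, - y)"
        using shear_x[of "- x" "- y" b] by (simp add: zmul_minus)
      ultimately show ?thesis using True trans by (simp add: zmul_arith minus)
    qed
  next
    case False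
    \<comment> \<open>Division with remainder subtracts \<open>q\<close> times the second row from
      the first. The matrix with rows \<open>(c, d)\<close> and \<open>(- a', - b')\<close> has a
      smaller lower left entry; a quarter turn and a shear by \<open>- q\<close> then recover the
      original matrix.\<close>
    define q where "q = a div c"
    define a' where "a' = a - q * c"
    define b' where "b' = b - q * d"
    have "a' = a mod c" by (simp add: a'_def q_def minus_div_mult_eq_mod)
    hence "nat \<bar>- a'\<bar> < nat \<bar>c\<bar>" using False by (simp add: abs_mod_less)
    moreover have "c * (- b') - d * (- a') = 1"
      using less.prems by (simp add: a'_def b'_def algebra_simps)
    ultimately have "R (x, y) (zmul c x + zmul d y, zmul (- a') x + zmul (- b') y)" by (rule less.hyps)
    hence "R (x, y) (- (zmul (- a') x + zmul (- b') y), zmul c x + zmul d y)"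
      using rot trans by blast
    moreover have "- (zmul (- a') x + zmul (- b') y) - zmul (- q) (zmul c x + zmul d y)
        = zmul a x + zmul b y"
      unfolding a'_def b'_def by transfer (simp add: algebra_simps)
    ultimately show ?thesis using shear_x trans by metis
  qed
qed

lemma QHM_SL2Z:
  assumes "a * d - b * k = 1"
  shows "bimod_isomorphic C_torus (QHM_bimod c \<mu> \<nu>)
    C_torus (QHM_bimod c (zmul a \<mu> + zmul b \<nu>) (zmul k \<mu> + zmul d \<nu>))"
proof -
  let ?R = "\<lambda>p q. bimod_isomorphic C_torus (QHM_bimod c (fst p) (snd p)) C_torus (QHM_bimod c (fst q) (snd q))"
  have "?R (\<mu>, \<nu>) (zmul a \<mu> + zmul b \<nu>, zmul k \<mu> + zmul d \<nu>)"
    by (rule SL2Z_shear_induct[where R = ?R, OF _ _ _ assms])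
      (auto intro: bimod_isomorphic_trans hilbert_bimodule_QHM QHM_shear_x QHM_shear_y)
  thus ?thesis by simp
qed

theorem theorem2p2:
  fixes c :: nat and \<mu> \<nu> \<mu>' \<nu>' :: circle
    and D :: "'d cstar" and D' :: "'e cstar"
  assumes "c > 0"
    and "same_GL2Z_orbit (\<mu>, \<nu>) (\<mu>', \<nu>')"
    and "is_quantum_heisenberg_manifold c \<mu> \<nu> D"
    and "is_quantum_heisenberg_manifold c \<mu>' \<nu>' D'"
  shows "cstar_isomorphic D D'"
proof -
  obtain g :: "int^2^2" where g: "invertible g" "GL2Z_act g (\<mu>, \<nu>) = (\<mu>', \<nu>')"
    using assms(2) unfolding same_GL2Z_orbit_def by blast
  let ?a = "g $ 1 $ 1" and ?b = "g $ 1 $ 2" and ?k = "g $ 2 $ 1" and ?d = "g $ 2 $ 2"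
  have q: "\<mu>' = zmul ?a \<mu> + zmul ?b \<nu>" "\<nu>' = zmul ?k \<mu> + zmul ?d \<nu>"
    using g(2) by (auto simp: GL2Z_act_def)
  obtain g' where "g ** g' = mat 1" using g(1) unfolding invertible_def by blast
  hence "det g * det g' = 1" by (metis det_I det_mul)
  hence "det g = 1 \<or> det g = -1" by (auto simp: zmult_eq_1_iff)
  hence det: "?a * ?d - ?b * ?k = 1 \<or> ?a * ?d - ?b * ?k = -1" by (simp add: det_2)
  have D: "is_crossed_product C_torus (QHM_bimod c \<mu> \<nu>) D"
    and D': "is_crossed_product C_torus (QHM_bimod c \<mu>' \<nu>') D'"
    using assms(3,4) by (simp_all add: is_quantum_heisenberg_manifold_def)
  from det show ?thesis
  proof
    assume "?a * ?d - ?b * ?k = 1"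
    thus ?thesis
      using bimod_isomorphic_crossed_product[OF D D'] QHM_SL2Z unfolding q by blast
  next
    assume det: "?a * ?d - ?b * ?k = -1"
    \<comment> \<open>Negating the first column of \<open>g\<close> gives determinant 1, and
      negating \<mu> as well leaves the image point unchanged, so \<open>QHM_SL2Z\<close> applies to
      \<open>(- \<mu>, \<nu>)\<close>.\<close>
    have "zmul (- l) (- u) = zmul l u" for l u by transfer simp
    hence "bimod_isomorphic C_torus (QHM_bimod c (- \<mu>) \<nu>) C_torus (QHM_bimod c \<mu>' \<nu>')"
      using QHM_SL2Z[where a = "- ?a" and b = ?b and k = "- ?k" and d = ?d and c = c and \<mu> = "- \<mu>" and \<nu> = \<nu>] det by (simp add: q)
    moreover have "bimod_isomorphic C_torus (conj_bimod C_torus (QHM_bimod c \<mu> \<nu>))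
        C_torus (QHM_bimod c (- \<mu>) \<nu>)"
      using bimod_isomorphic_sym[OF hilbert_bimodule_QHM QHM_conj[where \<mu> = "- \<mu>" and \<nu> = \<nu>]] by simp
    ultimately have "bimod_isomorphic C_torus (conj_bimod C_torus (QHM_bimod c \<mu> \<nu>))
        C_torus (QHM_bimod c \<mu>' \<nu>')"
      using bimod_isomorphic_trans[OF hilbert_bimodule_conj[OF hilbert_bimodule_QHM]] by blast
    thus ?thesis
      using bimod_isomorphic_crossed_product[OF is_crossed_product_conj[OF D] D'] by blast
  qed
qed

end
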